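(* Let $\Gamma$ be a finitely generated and recursively presented group, $\Gamma \curvearrowright X$ be an EDS and $\Gamma\curvearrowright Y$ be a zero-dimensional topological factor of $\Gamma\curvearrowright X$. Then $\Gamma\curvearrowright Y$ is a WEDS.
   Context: All actions are by homeomorphisms on compact metrizable spaces; zero-dimensional means compact, metrizable and of topological dimension zero. r.e. means recursively enumerable. A topological factor of $\Gamma\curvearrowright X$ is an action $\Gamma\curvearrowright Y$ for which there is a continuous surjective $\Gamma$-equivariant map $X\to Y$; a topological conjugacy is an equivariant homeomorphism. A finitely generated group is recursively presented if for some (equivalently, any) finite symmetric generating set $S$ the set of words in $S^*$ representing the identity is r.e. EDS. A computable metric space is $(X,d,\mathcal{S})$ where $(X,d)$ is a separable metric space, $\mathcal{S}=\{s_i: i\ge 0\}$ is dense, and there is an algorithm which on input $(i,j,n)$ outputs $r\in\mathbb{Q}$ with $|d(s_i,s_j)-r|\le 2^{-n}$. Basic balls are open balls centered at points of $\mathcal{S}$ with positive rational radius; fix a computable enumeration $(B_n)_{n\in\mathbb{N}}$ of them and put $U_I=\bigcup_{n\in I}B_n$. A compact set $K\subset X$ is recursively compact if there is an algorithm which, given a finite $I\subset\mathbb{N}$, halts iff $K\subset U_I$. A map $f\colon Y\subset X\to X'$ between computable metric spaces is computable if there is an algorithm which, given $m$, enumerates $I_m$ with $f^{-1}(B'_m)=U_{I_m}\cap Y$, where $(B'_m)_m$ enumerates the basic balls of $X'$. An action of a finitely generated group on a recursively compact subset of a computable metric space is computable if for some (equivalently any) finite generating set each generator acts by a computable map. An action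 of a finitely generated group on a compact metrizable space is an effective dynamical system (EDS) if it is topologically conjugate to a computable action on some recursively compact subset of a computable metric space. Effective subshifts. For a finite alphabet $A$, $\Gamma$ acts on $A^\Gamma$ (prodiscrete topology) by $(gx)(h)=x(g^{-1}h)$; a $\Gamma$-subshift is a closed $\Gamma$-invariant subset. Let $S$ be a finite generating set of $\Gamma$, $F(S)$ the free group on $S$, $\phi\colon F(S)\to\Gamma$ the canonical epimorphism. The pullback of a subshift $X\subset A^\Gamma$ is $\widehat X=\{x\circ\phi:x\in X\}\subset A^{F(S)}$. $X$ is effective if for some (equivalently any) finite generating set $S$ the set $\widehat X$ is effectively closed in $A^{F(S)}$, i.e. the set of patterns $p\colon W\to A$, $W\subset F(S)$ finite, such that no $y\in\widehat X$ satisfies $y|_W=p$ is r.e. WEDS. An action $\Gamma\curvearrowright X$ on a zero-dimensional space is a weak effective dynamical system (WEDS) if for every clopen partition $\mathcal P=(P_i)_{i=1}^n$ of $X$ the subshift $$Y(\Gamma\curvearrowright X,\mathcal P)=\{y\in\{1,\dots,n\}^\Gamma:\text{there is }x\in X\text{ such that }g^{-1}x\in P_{y(g)}\text{ for every }g\in\Gamma\}$$ is effective. *)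

theory Defs
  imports
    "HOL-Analysis.Analysis"
    "HOL-Algebra.Generated_Groups"
    "HOL-Algebra.Group_Action"
    "HOL-Library.Nat_Bijection"
begin

text \<open>
  Programs carry no arity: the same program may be run on argument lists of any length, and for
  each fixed length it denotes a partial recursive function (possibly the nowhere defined one).
\<close>

datatype recf =
    Zero
  | Succ
  | Proj nat
  | Comp recf "recf list"
  | PrimRec recf recf
  | Minim recf

primrec rf_eval :: "recf \<Rightarrow> nat list \<Rightarrow> nat option" where
  "rf_eval Zero xs = Some 0"
| "rf_eval Succ xs = (case xs of [x] \<Rightarrow> Some (Suc x) | _ \<Rightarrow> None)"
| "rf_eval (Proj i) xs = (if i < length xs then Some (xs ! i) else None)"
| "rf_eval (Comp f gs) xs =
     Option.bind (those (map (\<lambda>g. rf_eval g xs) gs)) (\<lambda>ys. rf_eval f ys)"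
| "rf_eval (PrimRec f g) xs =
     (case xs of
        [] \<Rightarrow> None
      | n # ys \<Rightarrow> rec_nat (rf_eval f ys) (\<lambda>m r. Option.bind r (\<lambda>v. rf_eval g (m # v # ys))) n)"
| "rf_eval (Minim f) xs =
     (let P = (\<lambda>n. rf_eval f (n # xs) = Some 0 \<and> (\<forall>m<n. rf_eval f (m # xs) \<noteq> None))
      in if \<exists>n. P n then Some (LEAST n. P n) else None)"

definition halts :: "recf \<Rightarrow> nat list \<Rightarrow> bool" where
  "halts p xs \<longleftrightarrow> rf_eval p xs \<noteq> None"

definition re_set :: "nat set \<Rightarrow> bool" where
  "re_set A \<longleftrightarrow> (\<exists>p. \<forall>n. n \<in> A \<longleftrightarrow> halts p [n])"

definition re_family :: "(nat \<Rightarrow> nat set) \<Rightarrow> bool" where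
  "re_family A \<longleftrightarrow> (\<exists>p. \<forall>m n. n \<in> A m \<longleftrightarrow> halts p [m, n])"

text \<open>Every rational has a code (in fact infinitely many).\<close>

definition rat_of_code :: "nat \<Rightarrow> rat" where
  "rat_of_code k = (case prod_decode k of (a, b) \<Rightarrow> of_int (int_decode a) / of_nat (Suc b))"

definition pos_rat_of_code :: "nat \<Rightarrow> rat" where
  "pos_rat_of_code k = (case prod_decode k of (a, b) \<Rightarrow> of_nat (Suc a) / of_nat (Suc b))"

definition computable_metric_space :: "'m set \<Rightarrow> ('m \<Rightarrow> 'm \<Rightarrow> real) \<Rightarrow> (nat \<Rightarrow> 'm) \<Rightarrow> bool" where
  "computable_metric_space M d s \<longleftrightarrow>
     Metric_space M d \<and> range s \<subseteq> M \<and>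
     Metric_space.mtopology M d closure_of range s = M \<and>
     (\<exists>p. \<forall>i j n. \<exists>c. rf_eval p [i, j, n] = Some c \<and>
        \<bar>d (s i) (s j) - of_rat (rat_of_code c)\<bar> \<le> (1 / 2) ^ n)"

definition basic_ball :: "'m set \<Rightarrow> ('m \<Rightarrow> 'm \<Rightarrow> real) \<Rightarrow> (nat \<Rightarrow> 'm) \<Rightarrow> nat \<Rightarrow> 'm set" where
  "basic_ball M d s n =
     (case prod_decode n of (i, k) \<Rightarrow>
        Metric_space.mball M d (s i) (of_rat (pos_rat_of_code k)))"

text \<open>Finite sets of naturals are given to programs by their canonical index
  \<^const>\<open>set_encode\<close>.\<close>

definition recursively_compact ::
    "'m set \<Rightarrow> ('m \<Rightarrow> 'm \<Rightarrow> real) \<Rightarrow> (nat \<Rightarrow> 'm) \<Rightarrow> 'm set \<Rightarrow> bool" where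
  "recursively_compact M d s K \<longleftrightarrow>
     compactin (Metric_space.mtopology M d) K \<and>
     (\<exists>p. \<forall>I. finite I \<longrightarrow>
        (halts p [set_encode I] \<longleftrightarrow> K \<subseteq> (\<Union>n\<in>I. basic_ball M d s n)))"

definition computable_map ::
    "'m set \<Rightarrow> ('m \<Rightarrow> 'm \<Rightarrow> real) \<Rightarrow> (nat \<Rightarrow> 'm) \<Rightarrow> 'm set \<Rightarrow>
     'n set \<Rightarrow> ('n \<Rightarrow> 'n \<Rightarrow> real) \<Rightarrow> (nat \<Rightarrow> 'n) \<Rightarrow> ('m \<Rightarrow> 'n) \<Rightarrow> bool" where
  "computable_map M d s Y M' d' s' f \<longleftrightarrow>
     Y \<subseteq> M \<and> f \<in> Y \<rightarrow> M' \<and>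
     (\<exists>I. re_family I \<and>
        (\<forall>m. {x \<in> Y. f x \<in> basic_ball M' d' s' m} = (\<Union>n\<in>I m. basic_ball M d s n) \<inter> Y))"

definition generating_set :: "('g, 'b) monoid_scheme \<Rightarrow> 'g set \<Rightarrow> bool" where
  "generating_set G S \<longleftrightarrow> S \<subseteq> carrier G \<and> generate G S = carrier G"

definition finitely_generated :: "('g, 'b) monoid_scheme \<Rightarrow> bool" where
  "finitely_generated G \<longleftrightarrow> (\<exists>S. finite S \<and> generating_set G S)"

text \<open>A finite generating set is enumerated by a distinct list \<open>gs\<close>, and words over it are
  lists of indices into \<open>gs\<close>.\<close>

definition word_value :: "('g, 'b) monoid_scheme \<Rightarrow> 'g list \<Rightarrow> nat list \<Rightarrow> 'g" where
  "word_value G gs w = foldr (\<lambda>i x. gs ! i \<otimes>\<^bsub>G\<^esub> x) w \<one>\<^bsub>G\<^esub>"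

definition recursively_presented :: "('g, 'b) monoid_scheme \<Rightarrow> bool" where
  "recursively_presented G \<longleftrightarrow>
     (\<exists>gs. distinct gs \<and> generating_set G (set gs) \<and> (\<forall>g\<in>set gs. inv\<^bsub>G\<^esub> g \<in> set gs) \<and>
        re_set (list_encode ` {w \<in> lists {..<length gs}. word_value G gs w = \<one>\<^bsub>G\<^esub>}))"

definition top_action ::
    "('g, 'b) monoid_scheme \<Rightarrow> 'x topology \<Rightarrow> ('g \<Rightarrow> 'x \<Rightarrow> 'x) \<Rightarrow> bool" where
  "top_action G X \<phi> \<longleftrightarrow>
     compact_space X \<and> metrizable_space X \<and>
     group_action G (topspace X) \<phi> \<and> (\<forall>g\<in>carrier G. homeomorphic_map X X (\<phi> g))"

definition equivariant ::
    "('g, 'b) monoid_scheme \<Rightarrow> 'x topology \<Rightarrow> ('g \<Rightarrow> 'x \<Rightarrow> 'x) \<Rightarrow> ('g \<Rightarrow> 'y \<Rightarrow> 'y) \<Rightarrow>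
     ('x \<Rightarrow> 'y) \<Rightarrow> bool" where
  "equivariant G X \<phi> \<psi> f \<longleftrightarrow> (\<forall>g\<in>carrier G. \<forall>x\<in>topspace X. f (\<phi> g x) = \<psi> g (f x))"

definition topological_factor ::
    "('g, 'b) monoid_scheme \<Rightarrow> 'x topology \<Rightarrow> ('g \<Rightarrow> 'x \<Rightarrow> 'x) \<Rightarrow>
     'y topology \<Rightarrow> ('g \<Rightarrow> 'y \<Rightarrow> 'y) \<Rightarrow> bool" where
  "topological_factor G X \<phi> Y \<psi> \<longleftrightarrow>
     (\<exists>f. continuous_map X Y f \<and> f ` topspace X = topspace Y \<and> equivariant G X \<phi> \<psi> f)"

definition topologically_conjugate ::
    "('g, 'b) monoid_scheme \<Rightarrow> 'x topology \<Rightarrow> ('g \<Rightarrow> 'x \<Rightarrow> 'x) \<Rightarrow>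
     'y topology \<Rightarrow> ('g \<Rightarrow> 'y \<Rightarrow> 'y) \<Rightarrow> bool" where
  "topologically_conjugate G X \<phi> Y \<psi> \<longleftrightarrow>
     (\<exists>f. homeomorphic_map X Y f \<and> equivariant G X \<phi> \<psi> f)"

text \<open>
  For compact metrizable spaces all the usual notions of dimension agree; the library's
  \<open>dim_le\<close> is the small inductive one. The empty space satisfies \<open>X dim_le 0\<close> as well.
\<close>

definition zero_dim_action ::
    "('g, 'b) monoid_scheme \<Rightarrow> 'x topology \<Rightarrow> ('g \<Rightarrow> 'x \<Rightarrow> 'x) \<Rightarrow> bool" where
  "zero_dim_action G X \<phi> \<longleftrightarrow> top_action G X \<phi> \<and> X dim_le 0"

definition computable_action ::
    "('g, 'b) monoid_scheme \<Rightarrow> 'm set \<Rightarrow> ('m \<Rightarrow> 'm \<Rightarrow> real) \<Rightarrow> (nat \<Rightarrow> 'm) \<Rightarrow> 'm set \<Rightarrow>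
     ('g \<Rightarrow> 'm \<Rightarrow> 'm) \<Rightarrow> bool" where
  "computable_action G M d s K \<phi> \<longleftrightarrow>
     top_action G (subtopology (Metric_space.mtopology M d) K) \<phi> \<and>
     (\<exists>S. finite S \<and> generating_set G S \<and>
        (\<forall>g\<in>S. computable_map M d s K M d s (\<phi> g)))"

text \<open>
  HOL cannot quantify existentially over the type that carries the computable metric space, so it
  is a parameter. A theorem that assumes \<open>EDS TYPE('m) G X \<phi>\<close> with \<open>'m\<close> a type variable
  applies to computable metric spaces over an arbitrary type.
\<close>

definition EDS ::
    "'m itself \<Rightarrow> ('g, 'b) monoid_scheme \<Rightarrow> 'x topology \<Rightarrow> ('g \<Rightarrow> 'x \<Rightarrow> 'x) \<Rightarrow> bool" where
  "EDS (_ :: 'm itself) G X \<phi> \<longleftrightarrow>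
     finitely_generated G \<and> top_action G X \<phi> \<and>
     (\<exists>(M :: 'm set) d s K \<psi>.
        computable_metric_space M d s \<and> recursively_compact M d s K \<and>
        computable_action G M d s K \<psi> \<and>
        topologically_conjugate G X \<phi> (subtopology (Metric_space.mtopology M d) K) \<psi>)"

definition shift ::
    "('g, 'b) monoid_scheme \<Rightarrow> 'g \<Rightarrow> ('g \<Rightarrow> nat) \<Rightarrow> ('g \<Rightarrow> nat)" where
  "shift G g x = (\<lambda>h\<in>carrier G. x (inv\<^bsub>G\<^esub> g \<otimes>\<^bsub>G\<^esub> h))"

definition subshift :: "('g, 'b) monoid_scheme \<Rightarrow> nat set \<Rightarrow> ('g \<Rightarrow> nat) set \<Rightarrow> bool" where
  "subshift G A X \<longleftrightarrow>
     finite A \<and>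
     closedin (product_topology (\<lambda>_. discrete_topology A) (carrier G)) X \<and>
     (\<forall>g\<in>carrier G. \<forall>x\<in>X. shift G g x \<in> X)"

text \<open>
  The free group on a set of size \<open>k\<close>, as the set of reduced words: the letter \<open>(i, True)\<close> is the
  \<open>i\<close>-th generator and \<open>(i, False)\<close> its inverse. Only this underlying set and the canonical map
  to \<open>G\<close> enter the definition of effectiveness, not the multiplication.
\<close>

type_synonym fword = "(nat \<times> bool) list"

definition free_group_words :: "nat \<Rightarrow> fword set" where
  "free_group_words k =
     {w. fst ` set w \<subseteq> {..<k} \<and> successively (\<lambda>(i, b) (j, c). i = j \<longrightarrow> b = c) w}"

definition free_group_map :: "('g, 'b) monoid_scheme \<Rightarrow> 'g list \<Rightarrow> fword \<Rightarrow> 'g" where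
  "free_group_map G gs w =
     foldr (\<lambda>(i, b) x. (if b then gs ! i else inv\<^bsub>G\<^esub> (gs ! i)) \<otimes>\<^bsub>G\<^esub> x) w \<one>\<^bsub>G\<^esub>"

definition pullback ::
    "('g, 'b) monoid_scheme \<Rightarrow> 'g list \<Rightarrow> ('g \<Rightarrow> nat) set \<Rightarrow> (fword \<Rightarrow> nat) set" where
  "pullback G gs X =
     (\<lambda>x. \<lambda>w\<in>free_group_words (length gs). x (free_group_map G gs w)) ` X"

definition fword_encode :: "fword \<Rightarrow> nat" where
  "fword_encode w = list_encode (map (\<lambda>(i, b). 2 * i + of_bool b) w)"

text \<open>A pattern is a finite partial map; its code is the canonical index of its graph.\<close>

definition patterns :: "nat \<Rightarrow> nat set \<Rightarrow> (fword \<rightharpoonup> nat) set" where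
  "patterns k A = {p. finite (dom p) \<and> dom p \<subseteq> free_group_words k \<and> ran p \<subseteq> A}"

definition pattern_encode :: "(fword \<rightharpoonup> nat) \<Rightarrow> nat" where
  "pattern_encode p = set_encode {prod_encode (fword_encode w, a) | w a. p w = Some a}"

definition effectively_closed :: "nat \<Rightarrow> nat set \<Rightarrow> (fword \<Rightarrow> nat) set \<Rightarrow> bool" where
  "effectively_closed k A Z \<longleftrightarrow>
     re_set (pattern_encode `
       {p \<in> patterns k A. \<not> (\<exists>y\<in>Z. \<forall>w\<in>dom p. p w = Some (y w))})"

definition effective_subshift ::
    "('g, 'b) monoid_scheme \<Rightarrow> nat set \<Rightarrow> ('g \<Rightarrow> nat) set \<Rightarrow> bool" where
  "effective_subshift G A X \<longleftrightarrow>
     subshift G A X \<and>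
     (\<exists>gs. distinct gs \<and> generating_set G (set gs) \<and>
        effectively_closed (length gs) A (pullback G gs X))"

text \<open>Empty parts are allowed.\<close>

definition clopen_partition :: "'x topology \<Rightarrow> nat \<Rightarrow> (nat \<Rightarrow> 'x set) \<Rightarrow> bool" where
  "clopen_partition X n P \<longleftrightarrow>
     (\<forall>i\<in>{1..n}. openin X (P i) \<and> closedin X (P i)) \<and>
     disjoint_family_on P {1..n} \<and> (\<Union>i\<in>{1..n}. P i) = topspace X"

definition coding_subshift ::
    "('g, 'b) monoid_scheme \<Rightarrow> 'x topology \<Rightarrow> ('g \<Rightarrow> 'x \<Rightarrow> 'x) \<Rightarrow> nat \<Rightarrow> (nat \<Rightarrow> 'x set) \<Rightarrow>
     ('g \<Rightarrow> nat) set" where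
  "coding_subshift G X \<phi> n P =
     {y \<in> carrier G \<rightarrow>\<^sub>E {1..n}.
        \<exists>x\<in>topspace X. \<forall>g\<in>carrier G. \<phi> (inv\<^bsub>G\<^esub> g) x \<in> P (y g)}"

definition WEDS ::
    "('g, 'b) monoid_scheme \<Rightarrow> 'x topology \<Rightarrow> ('g \<Rightarrow> 'x \<Rightarrow> 'x) \<Rightarrow> bool" where
  "WEDS G X \<phi> \<longleftrightarrow>
     zero_dim_action G X \<phi> \<and>
     (\<forall>n P. clopen_partition X n P \<longrightarrow>
        effective_subshift G {1..n} (coding_subshift G X \<phi> n P))"

end

(* A pattern fails to occur iff the points violating it at some word cover the recursively compact
   space. For a partition pulled back from the factor, the points violating a pattern at a given word
   form a union of basic balls that is recursively enumerable uniformly in the word, so a finite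
   subcover can be searched for. For generators this is computability of the action; for their
   inverses, which the definition of a computable action does not mention, it follows from recursive
   compactness. *)
theory Submission
  imports Defs
begin

section \<open>Total computable functions\<close>

text \<open>The factor map is only continuous, so no algorithm for it is available. What rescues the
  argument is that preimages of the parts are clopen in the compact model \<open>K\<close>: the
  complement of each is cut out by a finite list of basic balls, and a finite list can be built into
  a program as a constant. The partition is quoted, never computed. Everything else that has to be
  tested is existential over decidable checks: strict inequalities between distances, covers of
  \<open>K\<close>, paths of balls along a word. Semidecidability is therefore taken to be
  projection of a decidable relation, which turns closure under quantifiers into packing of
  witnesses. Arbitrary programs are brought into this form by induction on their syntax, one program
  at a time, so neither a universal machine nor dovetailing is constructed. Only the union of the
  enumerated balls matters, never which balls are listed. This permits merely sufficient tests where
  inclusion between sets is not visibly semidecidable.\<close>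

definition computable :: "(nat \<Rightarrow> nat) \<Rightarrow> bool" where
  "computable f \<longleftrightarrow> (\<exists>p. \<forall>x. rf_eval p [x] = Some (f x))"

definition computable_binary :: "(nat \<Rightarrow> nat \<Rightarrow> nat) \<Rightarrow> bool" where
  "computable_binary f \<longleftrightarrow> (\<exists>p. \<forall>x y. rf_eval p [x, y] = Some (f x y))"

text \<open>Later notions concern functions and predicates of one number. Further arguments travel
  packed by the Cantor pairing, which is why relations appear as
  \<open>P (pfst z) (psnd z)\<close>.\<close>

definition pfst :: "nat \<Rightarrow> nat" where "pfst z = fst (prod_decode z)"
definition psnd :: "nat \<Rightarrow> nat" where "psnd z = snd (prod_decode z)"

lemma pfst_pair [simp]: "pfst (prod_encode (a, b)) = a"
  and psnd_pair [simp]: "psnd (prod_encode (a, b)) = b"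
  by (simp_all add: pfst_def psnd_def)

lemma pair_pfst_psnd [simp]: "prod_encode (pfst z, psnd z) = z"
  by (simp add: pfst_def psnd_def)

lemma computable_id: "computable (\<lambda>x. x)"
  unfolding computable_def by (intro exI[of _ "Proj 0"]) simp

lemma computable_binary_comp:
  assumes "computable_binary f" "computable g" "computable h"
  shows "computable (\<lambda>x. f (g x) (h x))"
proof -
  obtain p q r where "\<forall>x y. rf_eval p [x, y] = Some (f x y)" "\<forall>x. rf_eval q [x] = Some (g x)"
    "\<forall>x. rf_eval r [x] = Some (h x)"
    using assms unfolding computable_def computable_binary_def by blast
  then show ?thesis
    unfolding computable_def by (intro exI[of _ "Comp p [q, r]"]) simp
qed

lemma computable_comp:
  assumes "computable f" "computable g"
  shows "computable (\<lambda>x. f (g x))"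
proof -
  obtain p q where "\<forall>x. rf_eval p [x] = Some (f x)" "\<forall>x. rf_eval q [x] = Some (g x)"
    using assms unfolding computable_def by blast
  then show ?thesis
    unfolding computable_def by (intro exI[of _ "Comp p [q]"]) simp
qed

lemma computable_SucI: "computable f \<Longrightarrow> computable (\<lambda>x. Suc (f x))"
  by (rule computable_comp[of Suc]) (auto simp: computable_def intro!: exI[of _ Succ])

lemma computable_const: "computable (\<lambda>x. c)"
proof (induction c)
  case 0
  show ?case unfolding computable_def by (intro exI[of _ Zero]) simp
qed (rule computable_SucI)

section \<open>Addition, truncated subtraction and unbounded search\<close>

definition add_prog :: recf where
  "add_prog = PrimRec (Proj 0) (Comp Succ [Proj 1])"

lemma eval_add_prog: "rf_eval add_prog [x, y] = Some (x + y)"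
  unfolding add_prog_def by (induction x) simp_all

lemma computable_addI: "computable f \<Longrightarrow> computable g \<Longrightarrow> computable (\<lambda>x. f x + g x)"
  by (rule computable_binary_comp[of "(+)"]) (auto simp: computable_binary_def eval_add_prog intro!: exI[of _ add_prog])

text \<open>\<open>PrimRec\<close> recurses on the first argument, so this computes the second minus
  the first: the predecessor, itself a primitive recursion, is iterated.\<close>

definition diff_prog :: recf where
  "diff_prog = PrimRec (Proj 0) (Comp (PrimRec Zero (Proj 0)) [Proj 1])"

lemma eval_diff_prog: "rf_eval diff_prog [x, y] = Some (y - x)"
proof -
  have pred: "rf_eval (PrimRec Zero (Proj 0)) [n] = Some (n - 1)" for n
    by (induction n) simp_all
  show ?thesis
    unfolding diff_prog_def
  proof (induction x)
    case (Suc x)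
    then show ?case using pred[of "y - x"] by (simp del: One_nat_def)
  qed simp
qed

lemma computable_diffI: "computable f \<Longrightarrow> computable g \<Longrightarrow> computable (\<lambda>x. f x - g x)"
  by (rule computable_binary_comp[of "\<lambda>x y. y - x"])
    (auto simp: computable_binary_def eval_diff_prog intro!: exI[of _ diff_prog])

text \<open>\<open>Minim\<close> demands that all earlier values be defined, which totality of
  \<open>f\<close> supplies; the second hypothesis makes the search end.\<close>

lemma computable_LeastI:
  assumes "computable_binary f" "\<And>x. \<exists>n. f n x = 0"
  shows "computable (\<lambda>x. LEAST n. f n x = 0)"
proof -
  obtain p where "\<forall>x y. rf_eval p [x, y] = Some (f x y)"
    using assms(1) unfolding computable_binary_def by blast
  then show ?thesis
    unfolding computable_def using assms(2) by (intro exI[of _ "Minim p"]) simp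
qed

section \<open>Cantor pairing and its projections\<close>

definition triangle_prog :: recf where
  "triangle_prog = PrimRec Zero (Comp add_prog [Comp Succ [Proj 0], Proj 1])"

lemma eval_triangle_prog: "rf_eval triangle_prog [x] = Some (triangle x)"
  unfolding triangle_prog_def by (induction x) (simp_all add: eval_add_prog)

lemma computable_triangle: "computable triangle"
  using eval_triangle_prog unfolding computable_def by blast

definition pair_prog :: recf where
  "pair_prog = Comp add_prog [Comp triangle_prog [add_prog], Proj 0]"

lemma eval_pair_prog: "rf_eval pair_prog [x, y] = Some (prod_encode (x, y))"
  by (simp add: pair_prog_def eval_add_prog eval_triangle_prog prod_encode_def)

lemma computable_pairI: "computable f \<Longrightarrow> computable g \<Longrightarrow> computable (\<lambda>x. prod_encode (f x, g x))"
  by (rule computable_binary_comp[of "\<lambda>x y. prod_encode (x, y)"])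
    (auto simp: computable_binary_def eval_pair_prog intro!: exI[of _ pair_prog])

text \<open>The pair \<open>(a, b)\<close> lies on the antidiagonal \<open>a + b\<close>, whose
  codes run from \<open>triangle (a + b)\<close> up to but not including
  \<open>triangle (Suc (a + b))\<close>. The test \<open>z < triangle (Suc n)\<close> is written as
  a vanishing truncated difference because \<open>Minim\<close> searches for zeros.\<close>

definition diagonal :: "nat \<Rightarrow> nat" where
  "diagonal z = (LEAST n. Suc z - triangle (Suc n) = 0)"

lemma triangle_mono: "m \<le> n \<Longrightarrow> triangle m \<le> triangle n"
  by (induction rule: dec_induct) simp_all

lemma diagonal_pair: "diagonal (prod_encode (a, b)) = a + b"
  unfolding diagonal_def
proof (rule Least_equality)
  fix n assume "Suc (prod_encode (a, b)) - triangle (Suc n) = 0"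
  then have "triangle (a + b) < triangle (Suc n)"
    by (simp add: prod_encode_def)
  then show "a + b \<le> n"
    using triangle_mono[of "Suc n" "a + b"] by fastforce
qed (simp add: prod_encode_def)

lemma pfst_diagonal: "pfst z = z - triangle (diagonal z)"
  and psnd_diagonal: "psnd z = diagonal z - pfst z"
proof -
  obtain a b where "z = prod_encode (a, b)"
    by (metis pair_pfst_psnd)
  then show "pfst z = z - triangle (diagonal z)" "psnd z = diagonal z - pfst z"
    by (simp_all add: diagonal_pair) (simp add: prod_encode_def)
qed

lemma computable_diagonal: "computable diagonal"
  unfolding diagonal_def
proof (rule computable_LeastI)
  show "computable_binary (\<lambda>n z. Suc z - triangle (Suc n))"
    unfolding computable_binary_def
    by (intro exI[of _ "Comp diff_prog [Comp triangle_prog [Comp Succ [Proj 0]], Comp Succ [Proj 1]]"])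
      (simp add: eval_triangle_prog eval_diff_prog)
  have "n \<le> triangle n" for n by (induction n) simp_all
  then show "\<exists>n. Suc z - triangle (Suc n) = 0" for z
    by (metis diff_is_0_eq)
qed

lemma computable_pfst: "computable pfst"
proof -
  have "computable (\<lambda>z. z - triangle (diagonal z))"
    by (intro computable_diffI computable_comp[OF computable_triangle] computable_diagonal computable_id)
  then show ?thesis by (simp add: pfst_diagonal[abs_def])
qed

lemma computable_psnd: "computable psnd"
proof -
  have "computable (\<lambda>z. diagonal z - pfst z)"
    by (intro computable_diffI computable_diagonal computable_pfst)
  then show ?thesis by (simp add: psnd_diagonal[abs_def])
qed

lemmas computable_pfstI = computable_comp[OF computable_pfst] and computable_psndI = computable_comp[OF computable_psnd]

lemma computable_binary_iff: "computable_binary f \<longleftrightarrow> computable (\<lambda>z. f (pfst z) (psnd z))"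
proof
  assume "computable_binary f"
  then show "computable (\<lambda>z. f (pfst z) (psnd z))"
    using computable_binary_comp computable_pfst computable_psnd by blast
next
  assume "computable (\<lambda>z. f (pfst z) (psnd z))"
  then obtain p where "\<forall>z. rf_eval p [z] = Some (f (pfst z) (psnd z))"
    unfolding computable_def by blast
  then show "computable_binary f"
    unfolding computable_binary_def by (intro exI[of _ "Comp p [pair_prog]"]) (simp add: eval_pair_prog)
qed

text \<open>The step function receives counter, accumulator and parameter, in this order, as nested
  pairs.\<close>

lemma computable_recI:
  assumes "computable a" "computable (\<lambda>z. b (pfst z) (pfst (psnd z)) (psnd (psnd z)))" "computable n"
  shows "computable (\<lambda>x. rec_nat (a x) (\<lambda>m r. b m r x) (n x))"
proof -
  obtain p where p: "\<forall>x. rf_eval p [x] = Some (a x)"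
    using assms(1) unfolding computable_def by blast
  obtain q where q: "\<forall>z. rf_eval q [z] = Some (b (pfst z) (pfst (psnd z)) (psnd (psnd z)))"
    using assms(2) unfolding computable_def by blast
  let ?q = "Comp q [Comp pair_prog [Proj 0, Comp pair_prog [Proj 1, Proj 2]]]"
  have "rf_eval (PrimRec p ?q) [k, x] = Some (rec_nat (a x) (\<lambda>m r. b m r x) k)" for k x
    by (induction k) (use p q in \<open>simp_all add: eval_pair_prog\<close>)
  then have "computable_binary (\<lambda>k x. rec_nat (a x) (\<lambda>m r. b m r x) k)"
    unfolding computable_binary_def by blast
  from computable_binary_comp[OF this assms(3) computable_id] show ?thesis .
qed

lemmas computable_basic = computable_id computable_const computable_SucI computable_addI computable_diffI computable_pairI computable_pfstI computable_psndI

section \<open>Multiplication, powers and binary digits\<close>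

lemma computable_multI:
  assumes "computable f" "computable g"
  shows "computable (\<lambda>x. f x * g x)"
proof -
  have eq: "m * k = rec_nat 0 (\<lambda>_ r. r + k) m" for m k :: nat
    by (induction m) simp_all
  show ?thesis
    unfolding eq by (rule computable_recI[where b = "\<lambda>_ r x. r + g x"]) (rule computable_basic assms computable_comp[OF assms(2)])+
qed

lemma computable_powerI:
  assumes "computable f" "computable g"
  shows "computable (\<lambda>x. f x ^ g x)"
proof -
  have eq: "k ^ m = rec_nat 1 (\<lambda>_ r. r * k) m" for m k :: nat
    by (induction m) simp_all
  show ?thesis
    unfolding eq by (rule computable_recI[where b = "\<lambda>_ r x. r * f x"])
      (rule computable_basic assms computable_multI computable_comp[OF assms(1)])+
qed

lemma computable_half: "computable (\<lambda>x. x div 2)"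
proof -
  \<comment> \<open>The two halves of \<open>n\<close>, rounded down and rounded up, add up to
    \<open>n\<close>; hence half of \<open>Suc n\<close> is \<open>n\<close> minus half of
    \<open>n\<close>.\<close>
  have eq: "m div 2 = rec_nat 0 (\<lambda>n r. n - r) m" for m :: nat
  proof (induction m)
    case (Suc m)
    then show ?case using div_add_self1[of 2 m]
      by (simp flip: Suc.IH)
  qed simp
  show ?thesis
    unfolding eq by (rule computable_recI[where b = "\<lambda>n r _. n - r"]) (rule computable_basic)+
qed

lemmas computable_halfI = computable_comp[OF computable_half]

lemma computable_mod2: "computable (\<lambda>x. x mod 2)"
proof -
  have "x mod 2 = x - 2 * (x div 2)" for x :: nat
    by (simp add: minus_mult_div_eq_mod)
  then show ?thesis
    by (simp only:) (rule computable_basic computable_multI computable_half)+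
qed

text \<open>Right shifts read off the binary digits of a number, and thereby membership in the
  finite set that it codes.\<close>

lemma computable_shiftI:
  assumes "computable f" "computable g"
  shows "computable (\<lambda>x. f x div 2 ^ g x)"
proof -
  have eq: "k div 2 ^ m = rec_nat k (\<lambda>_ r. r div 2) m" for m k :: nat
  proof (induction m)
    case (Suc m)
    have "k div 2 ^ Suc m = k div 2 ^ m div 2"
      by (simp only: power_Suc2 div_mult2_eq)
    with Suc show ?case by simp
  qed simp
  show ?thesis
    unfolding eq by (rule computable_recI[where b = "\<lambda>_ r _. r div 2"]) (rule computable_basic assms computable_halfI)+
qed

section \<open>Decidable and semidecidable predicates\<close>

definition decidable :: "(nat \<Rightarrow> bool) \<Rightarrow> bool" where
  "decidable P \<longleftrightarrow> computable (\<lambda>x. of_bool (P x))"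

lemma decidable_comp: "decidable P \<Longrightarrow> computable f \<Longrightarrow> decidable (\<lambda>x. P (f x))"
  unfolding decidable_def by (rule computable_comp)

lemma decidable_const: "decidable (\<lambda>x. c)"
  unfolding decidable_def by (rule computable_const)

lemma decidable_not:
  assumes "decidable P"
  shows "decidable (\<lambda>x. \<not> P x)"
proof -
  have "of_bool (\<not> b) = 1 - (of_bool b :: nat)" for b by simp
  then show ?thesis
    unfolding decidable_def by (simp only:) (rule computable_diffI computable_const assms[unfolded decidable_def])+
qed

lemma decidable_conj:
  assumes "decidable P" "decidable Q"
  shows "decidable (\<lambda>x. P x \<and> Q x)"
  unfolding decidable_def of_bool_conj by (intro computable_multI assms[unfolded decidable_def])

lemma decidable_disj:
  assumes "decidable P" "decidable Q"
  shows "decidable (\<lambda>x. P x \<or> Q x)"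
  using decidable_not[OF decidable_conj[OF decidable_not[OF assms(1)] decidable_not[OF assms(2)]]] by simp

lemma decidable_le:
  assumes "computable f" "computable g"
  shows "decidable (\<lambda>x. f x \<le> g x)"
proof -
  have "of_bool (m \<le> n) = 1 - (m - n)" for m n :: nat by simp
  then show ?thesis
    unfolding decidable_def by (simp only:) (rule computable_diffI computable_const assms)+
qed

lemma decidable_less: "computable f \<Longrightarrow> computable g \<Longrightarrow> decidable (\<lambda>x. f x < g x)"
  unfolding less_eq_Suc_le by (intro decidable_le computable_SucI)

lemma decidable_eq: "computable f \<Longrightarrow> computable g \<Longrightarrow> decidable (\<lambda>x. f x = g x)"
  unfolding order_eq_iff[where 'a = nat] by (intro decidable_conj decidable_le)

lemma decidable_odd: "computable f \<Longrightarrow> decidable (\<lambda>x. odd (f x))"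
  unfolding odd_iff_mod_2_eq_one by (intro decidable_eq computable_comp[OF computable_mod2] computable_const)

lemma decidable_even: "computable f \<Longrightarrow> decidable (\<lambda>x. even (f x))"
  using decidable_not[OF decidable_odd] by simp

lemma decidable_set_decode: "computable f \<Longrightarrow> computable g \<Longrightarrow> decidable (\<lambda>x. f x \<in> set_decode (g x))"
  unfolding set_decode_def mem_Collect_eq by (intro decidable_odd computable_shiftI)

text \<open>A bounded quantifier is the product of the characteristic values, accumulated by
  primitive recursion.\<close>

lemma decidable_ball_less:
  assumes "decidable (\<lambda>z. P (pfst z) (psnd z))" "computable n"
  shows "decidable (\<lambda>x. \<forall>i<n x. P i x)"
proof -
  have eq: "of_bool (\<forall>i<k. P i x) = rec_nat (1::nat) (\<lambda>m r. r * of_bool (P m x)) k" for k x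
  proof (induction k)
    case (Suc k)
    have "of_bool (\<forall>i<Suc k. P i x) = (of_bool (\<forall>i<k. P i x) * of_bool (P k x) :: nat)"
      by (auto simp: less_Suc_eq)
    with Suc show ?case by simp
  qed simp
  have "decidable (\<lambda>z. P (pfst z) (psnd (psnd z)))"
    using decidable_comp[OF assms(1), of "\<lambda>z. prod_encode (pfst z, psnd (psnd z))"]
    by (simp add: computable_basic)
  then show ?thesis
    unfolding decidable_def eq
    by (intro computable_recI[where b = "\<lambda>m r x. r * of_bool (P m x)"] computable_multI computable_basic assms(2))
qed

lemma decidable_bex_less:
  assumes "decidable (\<lambda>z. P (pfst z) (psnd z))" "computable n"
  shows "decidable (\<lambda>x. \<exists>i<n x. P i x)"
  using decidable_not[OF decidable_ball_less[OF decidable_not[OF assms(1)] assms(2)]] by simp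

lemma decidable_finite: "finite A \<Longrightarrow> computable f \<Longrightarrow> decidable (\<lambda>x. f x \<in> A)"
  by (induction A rule: finite_induct) (simp_all add: decidable_const decidable_disj decidable_eq computable_const)

text \<open>Bounding elements by the code turns quantification over a coded finite set into a
  bounded quantifier.\<close>

lemma less_of_mem_set_decode:
  assumes "e \<in> set_decode c"
  shows "e < c"
proof -
  have "0 < c div 2 ^ e"
    using assms unfolding set_decode_def by (blast intro: odd_pos)
  then have "2 ^ e \<le> c"
    by (simp add: div_greater_zero_iff)
  then show ?thesis
    using less_exp[of e] by linarith
qed

text \<open>The existential normal form of recursive enumerability; the agreement with halting
  programs is \<open>re_set_iff_sig\<close>. The witness \<open>t\<close> may be thought of as a
  stage of the search.\<close>

definition semidecidable :: "(nat \<Rightarrow> bool) \<Rightarrow> bool" where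
  "semidecidable P \<longleftrightarrow> (\<exists>D. decidable (\<lambda>z. D (pfst z) (psnd z)) \<and> (\<forall>x. P x \<longleftrightarrow> (\<exists>t. D t x)))"

lemma semidecidable_dec: "decidable P \<Longrightarrow> semidecidable P"
  unfolding semidecidable_def by (intro exI[of _ "\<lambda>_. P"]) (simp add: decidable_comp computable_psnd)

lemma semidecidable_comp:
  assumes "semidecidable P" "computable f"
  shows "semidecidable (\<lambda>x. P (f x))"
proof -
  obtain D where D: "decidable (\<lambda>z. D (pfst z) (psnd z))" "\<forall>x. P x \<longleftrightarrow> (\<exists>t. D t x)"
    using assms(1) unfolding semidecidable_def by blast
  have "computable (\<lambda>z. prod_encode (pfst z, f (psnd z)))"
    by (rule computable_basic computable_comp[OF assms(2)])+
  from decidable_comp[OF D(1) this] show ?thesis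
    unfolding semidecidable_def using D(2) by (intro exI[of _ "\<lambda>t x. D t (f x)"]) simp
qed

lemma semidecidable_comp2:
  assumes "semidecidable (\<lambda>z. P (pfst z) (psnd z))" "computable f" "computable g"
  shows "semidecidable (\<lambda>x. P (f x) (g x))"
  using semidecidable_comp[OF assms(1) computable_pairI[OF assms(2,3)]] by simp

text \<open>Packing the value of \<open>y\<close> and the stage into one number merges two unbounded
  searches into one.\<close>

lemma semidecidable_ex:
  assumes "semidecidable (\<lambda>z. P (pfst z) (psnd z))"
  shows "semidecidable (\<lambda>x. \<exists>y. P y x)"
proof -
  obtain D where D: "decidable (\<lambda>z. D (pfst z) (psnd z))" "\<forall>z. P (pfst z) (psnd z) \<longleftrightarrow> (\<exists>t. D t z)"
    using assms unfolding semidecidable_def by blast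
  have P: "P y x \<longleftrightarrow> (\<exists>t. D t (prod_encode (y, x)))" for x y
    using D(2)[rule_format, of "prod_encode (y, x)"] by simp
  have "(\<exists>y. P y x) \<longleftrightarrow> (\<exists>u. D (pfst u) (prod_encode (psnd u, x)))" for x
    unfolding P by (metis pfst_pair psnd_pair)
  moreover have "computable (\<lambda>z. prod_encode (pfst (pfst z), prod_encode (psnd (pfst z), psnd z)))"
    by (rule computable_basic)+
  from decidable_comp[OF D(1) this]
  have "decidable (\<lambda>z. D (pfst (pfst z)) (prod_encode (psnd (pfst z), psnd z)))" by simp
  ultimately show ?thesis
    unfolding semidecidable_def by (intro exI[of _ "\<lambda>u x. D (pfst u) (prod_encode (psnd u, x))"]) simp
qed

text \<open>Finitely many witnesses have a common bound. Searching for that bound leaves only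
  bounded quantifiers inside, so a single existential over a decidable test remains.\<close>

lemma semidecidable_ball_less:
  assumes "semidecidable (\<lambda>z. P (pfst z) (psnd z))" "computable n"
  shows "semidecidable (\<lambda>x. \<forall>i<n x. P i x)"
proof -
  obtain D where D: "decidable (\<lambda>z. D (pfst z) (psnd z))" "\<forall>z. P (pfst z) (psnd z) \<longleftrightarrow> (\<exists>t. D t z)"
    using assms unfolding semidecidable_def by blast
  have P: "P y x \<longleftrightarrow> (\<exists>t. D t (prod_encode (y, x)))" for x y
    using D(2)[rule_format, of "prod_encode (y, x)"] by simp
  have bound: "(\<forall>i<k. P i x) \<longleftrightarrow> (\<exists>b. \<forall>i<k. \<exists>t<b. D t (prod_encode (i, x)))" for k x
  proof (induction k)
    case (Suc k)
    have "\<exists>b. \<forall>i<Suc k. \<exists>t<b. D t (prod_encode (i, x))" if "\<forall>i<Suc k. P i x"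
    proof -
      from that Suc obtain b where b: "\<forall>i<k. \<exists>t<b. D t (prod_encode (i, x))" by auto
      from that obtain t where t: "D t (prod_encode (k, x))" unfolding P by auto
      have "\<forall>i<Suc k. \<exists>t'<max b (Suc t). D t' (prod_encode (i, x))"
        using b t by (metis less_Suc_eq less_max_iff_disj)
      then show ?thesis ..
    qed
    then show ?case unfolding P by blast
  qed simp
  have "computable (\<lambda>z. prod_encode (pfst z, prod_encode (pfst (psnd z), psnd (psnd (psnd z)))))"
    by (rule computable_basic)+
  from decidable_comp[OF D(1) this]
  have "decidable (\<lambda>z. D (pfst z) (prod_encode (pfst (psnd z), psnd (psnd (psnd z)))))" by simp
  from decidable_bex_less[OF this, of "\<lambda>z. pfst (psnd z)"]
  have "decidable (\<lambda>z. \<exists>t<pfst (psnd z). D t (prod_encode (pfst z, psnd (psnd z))))"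
    by (simp add: computable_basic)
  from decidable_ball_less[OF this computable_comp[OF assms(2) computable_psnd]]
  have "decidable (\<lambda>z. \<forall>i<n (psnd z). \<exists>t<pfst z. D t (prod_encode (i, psnd z)))" by simp
  then show ?thesis
    unfolding semidecidable_def bound
    by (intro exI[of _ "\<lambda>b x. \<forall>i<n x. \<exists>t<b. D t (prod_encode (i, x))"]) simp
qed

lemma semidecidable_conj:
  assumes "semidecidable P" "semidecidable Q"
  shows "semidecidable (\<lambda>x. P x \<and> Q x)"
proof -
  obtain D where D: "decidable (\<lambda>z. D (pfst z) (psnd z))" "\<forall>x. P x \<longleftrightarrow> (\<exists>t. D t x)"
    using assms(1) unfolding semidecidable_def by blast
  obtain E where E: "decidable (\<lambda>z. E (pfst z) (psnd z))" "\<forall>x. Q x \<longleftrightarrow> (\<exists>t. E t x)"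
    using assms(2) unfolding semidecidable_def by blast
  have "decidable (\<lambda>z. D (pfst (pfst z)) (psnd z))"
    using decidable_comp[OF D(1), of "\<lambda>z. prod_encode (pfst (pfst z), psnd z)"] by (simp add: computable_basic)
  moreover have "decidable (\<lambda>z. E (psnd (pfst z)) (psnd z))"
    using decidable_comp[OF E(1), of "\<lambda>z. prod_encode (psnd (pfst z), psnd z)"] by (simp add: computable_basic)
  moreover have "P x \<and> Q x \<longleftrightarrow> (\<exists>t. D (pfst t) x \<and> E (psnd t) x)" for x
    using D(2) E(2) by (metis pfst_pair psnd_pair)
  ultimately show ?thesis
    unfolding semidecidable_def by (intro exI[of _ "\<lambda>t x. D (pfst t) x \<and> E (psnd t) x"]) (simp add: decidable_conj)
qed

lemma semidecidable_disj:
  assumes "semidecidable P" "semidecidable Q"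
  shows "semidecidable (\<lambda>x. P x \<or> Q x)"
proof -
  obtain D where D: "decidable (\<lambda>z. D (pfst z) (psnd z))" "\<forall>x. P x \<longleftrightarrow> (\<exists>t. D t x)"
    using assms(1) unfolding semidecidable_def by blast
  obtain E where E: "decidable (\<lambda>z. E (pfst z) (psnd z))" "\<forall>x. Q x \<longleftrightarrow> (\<exists>t. E t x)"
    using assms(2) unfolding semidecidable_def by blast
  then show ?thesis
    unfolding semidecidable_def using decidable_disj[OF D(1) E(1)] D(2)
    by (intro exI[of _ "\<lambda>t x. D t x \<or> E t x"]) auto
qed

text \<open>The finite set is a constant of the algorithm, so the predicates \<open>P a\<close> need
  no uniformity in \<open>a\<close>.\<close>

lemma semidecidable_bex_finite:
  assumes "finite A" "\<And>a. a \<in> A \<Longrightarrow> semidecidable (P a)"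
  shows "semidecidable (\<lambda>x. \<exists>a\<in>A. P a x)"
  using assms by (induction A rule: finite_induct) (simp_all add: semidecidable_disj semidecidable_dec decidable_const)

lemma semidecidable_ball_finite:
  assumes "finite A" "\<And>a. a \<in> A \<Longrightarrow> semidecidable (P a)"
  shows "semidecidable (\<lambda>x. \<forall>a\<in>A. P a x)"
  using assms by (induction A rule: finite_induct) (simp_all add: semidecidable_conj semidecidable_dec decidable_const)

lemma semidecidable_ball_set_decode:
  assumes "semidecidable (\<lambda>z. P (pfst z) (psnd z))" "computable f"
  shows "semidecidable (\<lambda>x. \<forall>e\<in>set_decode (f x). P e x)"
proof -
  have "(\<forall>e\<in>set_decode c. P e x) \<longleftrightarrow> (\<forall>e<c. e \<notin> set_decode c \<or> P e x)" for c x
    using less_of_mem_set_decode by blast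
  then show ?thesis
    by (simp only:) (intro semidecidable_ball_less semidecidable_disj semidecidable_dec decidable_not decidable_set_decode computable_pfst
      computable_comp[OF assms(2) computable_psnd] assms)
qed

lemma semidecidable_bex_set_decode:
  assumes "semidecidable (\<lambda>z. P (pfst z) (psnd z))" "computable f"
  shows "semidecidable (\<lambda>x. \<exists>e\<in>set_decode (f x). P e x)"
  unfolding Bex_def by (intro semidecidable_ex semidecidable_conj semidecidable_dec decidable_set_decode computable_pfst
      computable_comp[OF assms(2) computable_psnd] assms)

text \<open>A path is witnessed by a finite set of pairs of an index and a state, in which every
  element is either initial or preceded by another one; the set need not be functional.\<close>

lemma relpowp_iff_trace:
  "(J ^^ n) a b \<longleftrightarrow>
    (\<exists>c. prod_encode (n, b) \<in> set_decode c \<and>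
      (\<forall>e\<in>set_decode c. e = prod_encode (0, a) \<or>
        (\<exists>e'\<in>set_decode c. pfst e = Suc (pfst e') \<and> J (psnd e') (psnd e))))"
  (is "_ \<longleftrightarrow> (\<exists>c. ?T c)")
proof
  assume "(J ^^ n) a b"
  then obtain f where f: "f 0 = a" "f n = b" "\<forall>i<n. J (f i) (f (Suc i))"
    unfolding relpowp_fun_conv by blast
  let ?c = "set_encode ((\<lambda>i. prod_encode (i, f i)) ` {..n})"
  have c: "set_decode ?c = (\<lambda>i. prod_encode (i, f i)) ` {..n}"
    by (rule set_encode_inverse) simp
  have "prod_encode (i, f i) = prod_encode (0, a) \<or> (\<exists>e'\<in>set_decode ?c. i = Suc (pfst e') \<and> J (psnd e') (f i))"
    if "i \<le> n" for i
    using that f unfolding c by (cases i) auto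
  then have "?T ?c"
    using f(2) unfolding c by force
  then show "\<exists>c. ?T c" ..
next
  assume "\<exists>c. ?T c"
  then obtain c where c: "?T c" ..
  \<comment> \<open>Several states may carry the same index, so the claim ranges over all of them.
    An element of index 0 has no predecessor and must therefore be the initial one.\<close>
  have "(J ^^ i) a u" if "prod_encode (i, u) \<in> set_decode c" for i u
    using that
  proof (induction i arbitrary: u)
    case 0
    then show ?case using c by force
  next
    case (Suc i)
    then obtain e' where "e' \<in> set_decode c" "i = pfst e'" "J (psnd e') u"
      using c by force
    with Suc.IH[of "psnd e'"] show ?case by auto
  qed
  then show "(J ^^ n) a b" using c by blast
qed

lemma semidecidable_relpowp:
  assumes J: "semidecidable (\<lambda>z. J (pfst z) (pfst (psnd z)) (psnd (psnd z)))" and f: "computable f" "computable g" "computable h"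
  shows "semidecidable (\<lambda>x. (J x ^^ f x) (g x) (h x))"
proof -
  have J': "semidecidable (\<lambda>x. J (a x) (b x) (c x))" if "computable a" "computable b" "computable c" for a b c
    using semidecidable_comp[OF J, of "\<lambda>x. prod_encode (a x, prod_encode (b x, c x))"] that
    by (simp add: computable_basic)
  show ?thesis
    unfolding relpowp_iff_trace
    by (rule semidecidable_ex semidecidable_conj semidecidable_ball_set_decode semidecidable_bex_set_decode semidecidable_disj J'
        semidecidable_dec[OF decidable_set_decode] semidecidable_dec[OF decidable_eq] computable_basic f f[THEN computable_comp])+
qed

lemma semidecidable_rtranclp:
  assumes "semidecidable (\<lambda>z. J (pfst z) (pfst (psnd z)) (psnd (psnd z)))" "computable g" "computable h"
  shows "semidecidable (\<lambda>x. (J x)\<^sup>*\<^sup>* (g x) (h x))"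
proof -
  have "(J x)\<^sup>*\<^sup>* = (\<lambda>a b. \<exists>n. (J x ^^ n) a b)" for x
    by (auto simp: fun_eq_iff rtranclp_power)
  moreover have "semidecidable (\<lambda>x. J (pfst x) (pfst (psnd x)) (psnd (psnd x)))" by fact
  then have "semidecidable (\<lambda>z. J (psnd (pfst z)) (pfst (psnd z)) (psnd (psnd z)))"
    using semidecidable_comp[of _ "\<lambda>z. prod_encode (psnd (pfst z), psnd z)", OF assms(1)] by (simp add: computable_basic)
  then have "semidecidable (\<lambda>z. (J (psnd z) ^^ pfst z) (g (psnd z)) (h (psnd z)))"
    by (rule semidecidable_relpowp[where J = "\<lambda>z. J (psnd z)"]) (rule computable_basic assms(2,3)[THEN computable_comp])+
  ultimately show ?thesis
    by (simp only:) (rule semidecidable_ex)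
qed

section \<open>Recursively enumerable sets\<close>

text \<open>Repeated splitting reads a number as an infinite sequence, so that one witness can guess
  the results of all inner programs of a \<open>Comp\<close> at once.\<close>

primrec entry :: "nat \<Rightarrow> nat \<Rightarrow> nat" where
  "entry 0 t = pfst t"
| "entry (Suc i) t = entry i (psnd t)"

lemma computable_entry: "computable (entry i)"
  by (induction i) (auto intro: computable_pfst computable_psnd computable_comp)

lemma ex_entries: "\<exists>t. \<forall>i<length ys. entry i t = ys ! i"
proof (induction ys)
  case (Cons y ys)
  then obtain t where t: "\<forall>i<length ys. entry i t = ys ! i" by blast
  show ?case
    by (intro exI[of _ "prod_encode (y, t)"]) (auto simp: t less_Suc_eq_0_disj)
qed simp

lemma those_eq_Some_iff:
  "those xs = Some ys \<longleftrightarrow> length xs = length ys \<and> (\<forall>i<length ys. xs ! i = Some (ys ! i))"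
proof (induction xs arbitrary: ys)
  case (Cons x xs)
  show ?case
    by (cases ys) (auto simp: Cons All_less_Suc2 split: option.split)
qed auto

lemma eval_Comp_iff:
  "rf_eval (Comp f gs) xs = Some y \<longleftrightarrow>
    (\<exists>t. (\<forall>i<length gs. rf_eval (gs ! i) xs = Some (entry i t)) \<and>
      rf_eval f (map (\<lambda>i. entry i t) [0..<length gs]) = Some y)"
  (is "?L \<longleftrightarrow> ?R")
proof
  assume ?L
  then obtain ys where ys: "those (map (\<lambda>g. rf_eval g xs) gs) = Some ys" "rf_eval f ys = Some y"
    by (auto simp: bind_eq_Some_conv)
  obtain t where "\<forall>i<length ys. entry i t = ys ! i"
    using ex_entries by blast
  moreover from this ys(1) have "ys = map (\<lambda>i. entry i t) [0..<length gs]"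
    by (auto simp: those_eq_Some_iff intro: nth_equalityI)
  ultimately show ?R
    using ys by (intro exI[of _ t]) (auto simp: those_eq_Some_iff)
next
  assume ?R
  then obtain t where t: "\<forall>i<length gs. rf_eval (gs ! i) xs = Some (entry i t)"
    "rf_eval f (map (\<lambda>i. entry i t) [0..<length gs]) = Some y" by blast
  from t(1) have "those (map (\<lambda>g. rf_eval g xs) gs) = Some (map (\<lambda>i. entry i t) [0..<length gs])"
    by (simp add: those_eq_Some_iff)
  with t(2) show ?L by simp
qed

text \<open>A primitive recursion is a path of length \<open>n\<close> through states consisting of
  counter and value; a diverging step has no successor. This makes evaluation an instance of
  iterating a semidecidable relation.\<close>

lemma eval_PrimRec_iff:
  "rf_eval (PrimRec f g) (n # ys) = Some y \<longleftrightarrow>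
    (\<exists>u. rf_eval f ys = Some u \<and>
      ((\<lambda>e e'. pfst e' = Suc (pfst e) \<and> rf_eval g (pfst e # psnd e # ys) = Some (psnd e')) ^^ n)
        (prod_encode (0, u)) (prod_encode (n, y)))"
  (is "_ \<longleftrightarrow> (\<exists>u. _ \<and> (?J ^^ n) _ _)")
proof -
  have "(?J ^^ k) (prod_encode (0, u)) e \<longleftrightarrow> pfst e = k \<and>
      rec_nat (Some u) (\<lambda>m r. Option.bind r (\<lambda>v. rf_eval g (m # v # ys))) k = Some (psnd e)" for k u e
  proof (induction k arbitrary: e)
    case 0
    show ?case using pair_pfst_psnd[of e] by (auto simp del: pair_pfst_psnd)
  next
    case (Suc k)
    show ?case
      by (auto simp: relcompp_apply Suc.IH bind_eq_Some_conv) (metis pfst_pair psnd_pair)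
  qed
  \<comment> \<open>If the base program diverges there is no starting value, and the recursion
    diverges at every index as well.\<close>
  moreover have "rec_nat None (\<lambda>m r. Option.bind r (\<lambda>v. rf_eval g (m # v # ys))) n = None"
    by (induction n) simp_all
  ultimately show ?thesis
    by (cases "rf_eval f ys") simp_all
qed

lemma Least_eq_iff:
  fixes P :: "nat \<Rightarrow> bool"
  shows "(\<exists>n. P n) \<and> (LEAST n. P n) = y \<longleftrightarrow> P y \<and> (\<forall>m<y. \<not> P m)"
proof
  assume "(\<exists>n. P n) \<and> (LEAST n. P n) = y"
  then show "P y \<and> (\<forall>m<y. \<not> P m)"
    using LeastI_ex not_less_Least by blast
next
  assume y: "P y \<and> (\<forall>m<y. \<not> P m)"
  then have "(LEAST n. P n) = y"
    by (intro Least_equality) (auto simp: not_less[symmetric])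
  with y show "(\<exists>n. P n) \<and> (LEAST n. P n) = y" by blast
qed

text \<open>"Defined and nonzero" is phrased positively, as having some successor value, because
  semidecidable predicates cannot be negated.\<close>

lemma eval_Minim_iff:
  "rf_eval (Minim f) xs = Some y \<longleftrightarrow>
    rf_eval f (y # xs) = Some 0 \<and> (\<forall>m<y. \<exists>v. rf_eval f (m # xs) = Some (Suc v))"
  (is "?L \<longleftrightarrow> ?R")
proof -
  define P where "P = (\<lambda>n. rf_eval f (n # xs) = Some 0 \<and> (\<forall>m<n. rf_eval f (m # xs) \<noteq> None))"
  have "?L \<longleftrightarrow> (\<exists>n. P n) \<and> (LEAST n. P n) = y"
    unfolding rf_eval.simps Let_def P_def[symmetric] by simp
  also have "\<dots> \<longleftrightarrow> P y \<and> (\<forall>m<y. \<not> P m)"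
    by (rule Least_eq_iff)
  also have "\<dots> \<longleftrightarrow> ?R"
  proof
    assume y: "P y \<and> (\<forall>m<y. \<not> P m)"
    have "\<exists>v. rf_eval f (m # xs) = Some (Suc v)" if m: "m < y" for m
    proof -
      have def: "rf_eval f (m # xs) \<noteq> None" "\<forall>k<m. rf_eval f (k # xs) \<noteq> None"
        using y m unfolding P_def by (simp_all del: not_None_eq)
      have "rf_eval f (m # xs) \<noteq> Some 0"
        using y m def(2) unfolding P_def by blast
      with def(1) obtain v where "rf_eval f (m # xs) = Some v" "v \<noteq> 0"
        by (cases "rf_eval f (m # xs)") simp_all
      then show ?thesis
        by (cases v) simp_all
    qed
    with y show ?R unfolding P_def by simp
  next
    assume ?R
    then show "P y \<and> (\<forall>m<y. \<not> P m)"
      unfolding P_def by fastforce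
  qed
  finally show ?thesis .
qed

text \<open>A normal form theorem for one fixed program, by induction on its syntax. Arguments and
  expected value are arbitrary computable functions of \<open>x\<close>, since the induction calls
  inner programs on guessed intermediate values that are themselves components of the packed
  input.\<close>

lemma semidecidable_eval:
  assumes "\<forall>f\<in>set fs. computable f" "computable h"
  shows "semidecidable (\<lambda>x. rf_eval p (map (\<lambda>f. f x) fs) = Some (h x))"
  using assms
proof (induction p arbitrary: fs h)
  case Zero
  then show ?case by (simp add: semidecidable_dec decidable_eq computable_const)
next
  case Succ
  show ?case
  proof (cases "\<exists>f. fs = [f]")
    case True
    then obtain f where "fs = [f]" ..
    with Succ show ?thesis by (simp add: semidecidable_dec decidable_eq computable_SucI)
  next
    case False
    then have "rf_eval Succ (map (\<lambda>f. f x) fs) = None" for x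
      by (auto split: list.split)
    then show ?thesis by (simp add: semidecidable_dec decidable_const del: rf_eval.simps)
  qed
next
  case (Proj i)
  then show ?case
    by (cases "i < length fs") (simp_all add: semidecidable_dec decidable_eq decidable_const)
next
  case (Comp p qs)
  have fs: "\<forall>f\<in>set fs. computable (\<lambda>z. f (psnd z))"
    using Comp.prems by (auto intro: computable_comp[OF _ computable_psnd])
  have "semidecidable (\<lambda>z. rf_eval (qs ! i) (map (\<lambda>f. f (psnd z)) fs) = Some (entry i (pfst z)))"
    if "i < length qs" for i
    using Comp.IH(2)[of "qs ! i" "map (\<lambda>f z. f (psnd z)) fs" "\<lambda>z. entry i (pfst z)"] that fs
    by (simp add: o_def computable_comp[OF computable_entry computable_pfst])
  moreover have "semidecidable (\<lambda>z. rf_eval p (map (\<lambda>i. entry i (pfst z)) [0..<length qs]) = Some (h (psnd z)))"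
    using Comp.IH(1)[of "map (\<lambda>i z. entry i (pfst z)) [0..<length qs]" "\<lambda>z. h (psnd z)"]
      computable_comp[OF Comp.prems(2) computable_psnd]
    by (simp add: o_def computable_comp[OF computable_entry computable_pfst])
  ultimately have "semidecidable (\<lambda>z. (\<forall>i\<in>{..<length qs}.
        rf_eval (qs ! i) (map (\<lambda>f. f (psnd z)) fs) = Some (entry i (pfst z))) \<and>
      rf_eval p (map (\<lambda>i. entry i (pfst z)) [0..<length qs]) = Some (h (psnd z)))"
    by (intro semidecidable_conj semidecidable_ball_finite) auto
  then show ?case
    unfolding eval_Comp_iff Ball_def lessThan_iff by (rule semidecidable_ex)
next
  case (PrimRec p q)
  show ?case
  proof (cases fs)
    case Nil
    then show ?thesis by (simp add: semidecidable_dec decidable_const)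
  next
    case (Cons n gs)
    have n: "computable n" and gs: "computable g \<Longrightarrow> \<forall>f\<in>set gs. computable (\<lambda>z. f (g z))" for g
      using PrimRec.prems Cons by (auto intro: computable_comp)
    have p: "semidecidable (\<lambda>z. rf_eval p (map (\<lambda>f. f (psnd z)) gs) = Some (pfst z))"
      using PrimRec.IH(1)[of "map (\<lambda>f z. f (psnd z)) gs" pfst] gs[OF computable_psnd] computable_pfst
      by (simp add: o_def)
    \<comment> \<open>Here \<open>w\<close> packs \<open>z\<close> with the two states of a step,
      and \<open>z\<close> packs the guessed base value with \<open>x\<close>.\<close>
    have "semidecidable (\<lambda>w. rf_eval q (pfst (pfst (psnd w)) # psnd (pfst (psnd w)) #
        map (\<lambda>f. f (psnd (pfst w))) gs) = Some (psnd (psnd (psnd w))))"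
      using PrimRec.IH(2)[of "(\<lambda>w. pfst (pfst (psnd w))) # (\<lambda>w. psnd (pfst (psnd w))) #
          map (\<lambda>f w. f (psnd (pfst w))) gs" "\<lambda>w. psnd (psnd (psnd w))"]
        gs[of "\<lambda>w. psnd (pfst w)"]
      by (simp add: o_def computable_basic)
    note J = semidecidable_conj[OF semidecidable_dec[OF decidable_eq] this]
    have "semidecidable (\<lambda>z. ((\<lambda>e e'. pfst e' = Suc (pfst e) \<and>
        rf_eval q (pfst e # psnd e # map (\<lambda>f. f (psnd z)) gs) = Some (psnd e')) ^^ n (psnd z))
        (prod_encode (0, pfst z)) (prod_encode (n (psnd z), h (psnd z))))"
      by (rule semidecidable_relpowp[where J = "\<lambda>z e e'. pfst e' = Suc (pfst e) \<and>
        rf_eval q (pfst e # psnd e # map (\<lambda>f. f (psnd z)) gs) = Some (psnd e')"])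
        (rule J computable_basic computable_comp[OF n] computable_comp[OF PrimRec.prems(2)])+
    from semidecidable_ex[OF semidecidable_conj[OF p this]] show ?thesis
      unfolding Cons list.map eval_PrimRec_iff by simp
  qed
next
  case (Minim p)
  have p: "semidecidable (\<lambda>x. rf_eval p (f x # map (\<lambda>f. f (g x)) fs) = Some (k x))"
    if "computable f" "computable g" "computable k" for f g k
  proof -
    have "\<forall>f\<in>set fs. computable (\<lambda>x. f (g x))"
      using Minim.prems(1) that(2) by (auto intro: computable_comp)
    with Minim.IH[of "f # map (\<lambda>f x. f (g x)) fs" k] that show ?thesis
      by (simp add: o_def)
  qed
  show ?case
    unfolding eval_Minim_iff
    by (rule semidecidable_conj p[where g = "\<lambda>x. x"] semidecidable_ball_less[where n = h] semidecidable_ex p computable_basic Minim.prems(2))+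
qed

lemma semidecidable_eval3:
  "computable f \<Longrightarrow> computable g \<Longrightarrow> computable k \<Longrightarrow> computable h \<Longrightarrow> semidecidable (\<lambda>x. rf_eval p [f x, g x, k x] = Some (h x))"
  using semidecidable_eval[of "[f, g, k]" h p] by simp

lemma semidecidable_halts:
  assumes "\<forall>f\<in>set fs. computable f"
  shows "semidecidable (\<lambda>x. halts p (map (\<lambda>f. f x) fs))"
proof -
  have "\<forall>f\<in>set fs. computable (\<lambda>z. f (psnd z))"
    using assms by (auto intro: computable_comp[OF _ computable_psnd])
  then have "semidecidable (\<lambda>z. rf_eval p (map (\<lambda>f. f (psnd z)) fs) = Some (pfst z))"
    using semidecidable_eval[of "map (\<lambda>f z. f (psnd z)) fs" pfst p] computable_pfst by (simp add: o_def)
  from semidecidable_ex[OF this] show ?thesis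
    by (simp add: halts_def)
qed

text \<open>Halting is a projection by the analysis of programs above. Conversely an unbounded
  search for a stage halts exactly on \<open>A\<close>; it looks for a zero, hence the negated
  test.\<close>

lemma re_set_iff_sig: "re_set A \<longleftrightarrow> semidecidable (\<lambda>n. n \<in> A)"
proof
  assume "re_set A"
  then obtain p where "\<forall>n. n \<in> A \<longleftrightarrow> halts p [n]"
    unfolding re_set_def by blast
  then show "semidecidable (\<lambda>n. n \<in> A)"
    using semidecidable_halts[of "[\<lambda>x. x]" p] by (simp add: computable_id)
next
  assume "semidecidable (\<lambda>n. n \<in> A)"
  then obtain D where D: "decidable (\<lambda>z. D (pfst z) (psnd z))" "\<forall>x. x \<in> A \<longleftrightarrow> (\<exists>t. D t x)"
    unfolding semidecidable_def by blast
  then have "computable_binary (\<lambda>t x. of_bool (\<not> D t x))"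
    unfolding computable_binary_iff using decidable_not[OF D(1)] by (simp only: decidable_def)
  then obtain p where "\<forall>t x. rf_eval p [t, x] = Some (of_bool (\<not> D t x))"
    unfolding computable_binary_def by blast
  moreover have "halts (Minim p) [n] \<longleftrightarrow> (\<exists>t. rf_eval p [t, n] = Some 0 \<and> (\<forall>m<t. rf_eval p [m, n] \<noteq> None))" for n
    unfolding halts_def rf_eval.simps Let_def by (simp del: not_None_eq)
  ultimately have "\<forall>n. n \<in> A \<longleftrightarrow> halts (Minim p) [n]"
    using D(2) by simp
  then show "re_set A"
    unfolding re_set_def by blast
qed

lemma semidecidable_re_family:
  assumes "re_family I"
  shows "semidecidable (\<lambda>z. psnd z \<in> I (pfst z))"
proof -
  obtain p where "\<forall>m n. n \<in> I m \<longleftrightarrow> halts p [m, n]"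
    using assms unfolding re_family_def by blast
  then show ?thesis
    using semidecidable_halts[of "[pfst, psnd]" p] by (simp add: computable_pfst computable_psnd)
qed

section \<open>Recursively compact sets\<close>

abbreviation radius :: "nat \<Rightarrow> real" where
  "radius n \<equiv> of_rat (pos_rat_of_code (psnd n))"

lemma basic_ball_eq: "basic_ball M d s n = Metric_space.mball M d (s (pfst n)) (radius n)"
  by (simp add: basic_ball_def pfst_def psnd_def split: prod.split)

lemma of_rat_pos_rat_of_code:
  "(of_rat (pos_rat_of_code k) :: real) = real (Suc (pfst k)) / real (Suc (psnd k))"
  by (cases "prod_decode k")
    (simp add: pos_rat_of_code_def pfst_def psnd_def of_rat_divide of_rat_add)

lemma radius_pos: "radius n > 0"
  unfolding of_rat_pos_rat_of_code by simp

lemma ex_small_radius: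
  assumes "e > 0"
  shows "\<exists>k. \<forall>i. radius (prod_encode (i, k)) < e"
proof -
  obtain b where "1 / real (Suc b) < e"
    using nat_approx_posE[OF assms] by metis
  then show ?thesis
    by (intro exI[of _ "prod_encode (0, b)"]) (simp add: of_rat_pos_rat_of_code)
qed

text \<open>A formal disjointness of balls. True disjointness is not visibly semidecidable, whereas
  a strict lower bound for the distance of two centres is confirmed by a good enough
  approximation.\<close>

definition far :: "('m \<Rightarrow> 'm \<Rightarrow> real) \<Rightarrow> (nat \<Rightarrow> 'm) \<Rightarrow> nat \<Rightarrow> nat \<Rightarrow> bool" where
  "far d s m n \<longleftrightarrow> radius m + radius n < d (s (pfst m)) (s (pfst n))"

text \<open>\<open>int_decode\<close> takes even codes to nonnegative and odd codes to negative
  integers, so only an even numerator code can exceed a positive number.\<close>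

lemma of_rat_rat_of_code_even:
  "even (pfst c) \<Longrightarrow> of_rat (rat_of_code c) = real (pfst c div 2) / real (Suc (psnd c))"
  by (cases "prod_decode c")
    (simp add: rat_of_code_def int_decode_def sum_decode_def pfst_def psnd_def of_rat_divide of_rat_add)

lemma of_rat_rat_of_code_odd:
  assumes "odd (pfst c)"
  shows "of_rat (rat_of_code c) \<le> (0 :: real)"
proof -
  have "rat_of_code c \<le> 0"
    using assms by (cases "prod_decode c")
      (simp add: rat_of_code_def int_decode_def sum_decode_def pfst_def divide_le_0_iff)
  then show ?thesis by simp
qed

text \<open>Clearing denominators leaves an inequality between natural numbers, for which closure
  under arithmetic gives decidability. The left side is positive, so odd codes fail.\<close>

lemma rat_test_iff:
  "(1 / 2) ^ N + (radius m + radius n) < of_rat (rat_of_code c) \<longleftrightarrow>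
    even (pfst c) \<and>
    (Suc (psnd (psnd m)) * Suc (psnd (psnd n)) +
      2 ^ N * (Suc (pfst (psnd m)) * Suc (psnd (psnd n)) + Suc (pfst (psnd n)) * Suc (psnd (psnd m))))
      * Suc (psnd c)
    < (pfst c div 2) * (2 ^ N * (Suc (psnd (psnd m)) * Suc (psnd (psnd n))))"
  (is "?l < _ \<longleftrightarrow> _ \<and> ?num * _ < _ * ?den")
proof (cases "even (pfst c)")
  case True
  have cross: "y / z < x / b \<longleftrightarrow> y * b < x * z" if "0 < b" "0 < z" for x y z b :: real
    using that by (simp add: field_simps)
  have sum: "1 / p + (a / b + a' / b') = (b * b' + p * (a * b' + a' * b)) / (p * (b * b'))"
    if "0 < p" "0 < b" "0 < b'" for p a b a' b' :: real
    using that by (simp add: field_simps)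
  have "?l = real ?num / real ?den"
    unfolding of_rat_pos_rat_of_code power_one_over of_nat_add of_nat_mult of_nat_power of_nat_numeral
    by (rule sum) simp_all
  then have "?l < of_rat (rat_of_code c) \<longleftrightarrow> real ?num / real ?den < real (pfst c div 2) / real (Suc (psnd c))"
    by (simp only: of_rat_rat_of_code_even[OF True])
  also have "\<dots> \<longleftrightarrow> real ?num * real (Suc (psnd c)) < real (pfst c div 2) * real ?den"
    by (rule cross) (simp_all only: of_nat_0_less_iff nat_0_less_mult_iff zero_less_Suc
        zero_less_power pos2 simp_thms)
  also have "\<dots> \<longleftrightarrow> ?num * Suc (psnd c) < pfst c div 2 * ?den"
    by (simp only: of_nat_less_iff flip: of_nat_mult)
  finally show ?thesis using True by simp
next
  case False
  have "0 < (1 / 2 :: real) ^ N + (radius m + radius n)"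
    by (intro add_pos_pos radius_pos) simp
  with of_rat_rat_of_code_odd[OF False] have "\<not> ?l < of_rat (rat_of_code c)"
    by linarith
  with False show ?thesis by blast
qed

lemma semidecidable_far:
  assumes "computable_metric_space M d s"
  shows "semidecidable (\<lambda>z. far d s (pfst z) (psnd z))"
proof -
  obtain p where p: "\<And>i j n. \<exists>c. rf_eval p [i, j, n] = Some c \<and>
      \<bar>d (s i) (s j) - of_rat (rat_of_code c)\<bar> \<le> (1 / 2) ^ n"
    using assms unfolding computable_metric_space_def by blast
  have "far d s m n \<longleftrightarrow> (\<exists>N c. rf_eval p [pfst m, pfst n, N] = Some c \<and>
      (1 / 2) ^ N + (radius m + radius n) < of_rat (rat_of_code c))" for m n
  proof
    let ?\<delta> = "d (s (pfst m)) (s (pfst n)) - (radius m + radius n)"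
    assume "far d s m n"
    then have "?\<delta> / 2 > 0" by (simp add: far_def)
    \<comment> \<open>Half of the gap, because the precision is spent twice: as error of the
      approximation and as margin in the test.\<close>
    then obtain N where N: "(1 / 2) ^ N < ?\<delta> / 2"
      using real_arch_pow_inv[of "?\<delta> / 2" "1 / 2"] by auto
    obtain c where c: "rf_eval p [pfst m, pfst n, N] = Some c"
      "\<bar>d (s (pfst m)) (s (pfst n)) - of_rat (rat_of_code c)\<bar> \<le> (1 / 2) ^ N"
      using p by blast
    with N have "(1 / 2) ^ N + (radius m + radius n) < of_rat (rat_of_code c)"
      by argo
    with c show "\<exists>N c. rf_eval p [pfst m, pfst n, N] = Some c \<and>
      (1 / 2) ^ N + (radius m + radius n) < of_rat (rat_of_code c)" by blast
  next
    assume "\<exists>N c. rf_eval p [pfst m, pfst n, N] = Some c \<and>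
      (1 / 2) ^ N + (radius m + radius n) < of_rat (rat_of_code c)"
    then obtain N c where c: "rf_eval p [pfst m, pfst n, N] = Some c" and
      less: "(1 / 2) ^ N + (radius m + radius n) < of_rat (rat_of_code c)" by blast
    with p[of "pfst m" "pfst n" N] have
      "\<bar>d (s (pfst m)) (s (pfst n)) - of_rat (rat_of_code c)\<bar> \<le> (1 / 2) ^ N" by auto
    with less show "far d s m n"
      unfolding far_def by argo
  qed
  then show ?thesis
    unfolding rat_test_iff
    by (simp only:) (rule semidecidable_ex semidecidable_conj semidecidable_eval3 semidecidable_dec[OF decidable_even] semidecidable_dec[OF decidable_less]
        computable_multI computable_powerI computable_halfI computable_basic)+
qed

section \<open>Covers, density and separation of basic balls\<close>

lemma semidecidable_cover:
  assumes "recursively_compact M d s K"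
  shows "semidecidable (\<lambda>c. K \<subseteq> (\<Union>n\<in>set_decode c. basic_ball M d s n))"
proof -
  obtain p where "\<And>I. finite I \<Longrightarrow> halts p [set_encode I] \<longleftrightarrow> K \<subseteq> (\<Union>n\<in>I. basic_ball M d s n)"
    using assms unfolding recursively_compact_def by blast
  from this[OF finite_set_decode] show ?thesis
    using semidecidable_halts[of "[\<lambda>c. c]" p] by (simp add: computable_id)
qed

lemma openin_basic_ball:
  assumes "Metric_space M d"
  shows "openin (Metric_space.mtopology M d) (basic_ball M d s n)"
  unfolding basic_ball_eq using assms by (simp add: Metric_space.openin_mball)

lemma compactin_finite_subcover:
  assumes "compactin X K" "\<And>n. n \<in> S \<Longrightarrow> openin X (B n)" "K \<subseteq> (\<Union>n\<in>S. B n)"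
  shows "\<exists>F. finite F \<and> F \<subseteq> S \<and> K \<subseteq> (\<Union>n\<in>F. B n)"
proof -
  have "\<exists>\<F>. finite \<F> \<and> \<F> \<subseteq> B ` S \<and> K \<subseteq> \<Union>\<F>"
    using assms by (intro compactinD) auto
  then show ?thesis
    using finite_subset_image by metis
qed

text \<open>The radius is fixed before the centre: density gives a centre within that radius of
  \<open>x\<close>, and symmetry of the distance puts \<open>x\<close> into the ball around
  it.\<close>

lemma dense_basic_ball:
  assumes "computable_metric_space M d s" "x \<in> M" "e > 0"
  shows "\<exists>n. x \<in> basic_ball M d s n \<and> radius n < e"
proof -
  interpret Metric_space M d
    using assms(1) by (simp add: computable_metric_space_def)
  obtain k where k: "\<And>i. radius (prod_encode (i, k)) < e"
    using ex_small_radius[OF assms(3)] by blast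
  have "x \<in> mtopology closure_of range s"
    using assms(1,2) by (simp add: computable_metric_space_def)
  then have "\<exists>y\<in>range s. y \<in> mball x (radius (prod_encode (0, k)))"
    unfolding metric_closure_of using radius_pos by blast
  then obtain i where "s i \<in> mball x (radius (prod_encode (0, k)))"
    by blast
  then have "x \<in> basic_ball M d s (prod_encode (i, k))"
    by (simp add: basic_ball_eq commute)
  with k show ?thesis by blast
qed

lemma far_disjoint:
  assumes "Metric_space M d" "far d s m n"
  shows "basic_ball M d s m \<inter> basic_ball M d s n = {}"
proof -
  interpret Metric_space M d by fact
  have False if "x \<in> basic_ball M d s m" "x \<in> basic_ball M d s n" for x
  proof -
    have "d (s (pfst m)) (s (pfst n)) \<le> d (s (pfst m)) x + d x (s (pfst n))"
      using that by (intro triangle) (auto simp: basic_ball_eq)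
    with that assms(2) show False
      by (simp add: far_def basic_ball_eq commute)
  qed
  then show ?thesis by blast
qed

text \<open>Although \<open>far\<close> is stronger than disjointness, far balls still exhaust
  everything outside the closed ball.\<close>

lemma exterior_covered_by_far:
  assumes "computable_metric_space M d s" "x \<in> M" "radius m < d (s (pfst m)) x"
  shows "\<exists>n. far d s m n \<and> x \<in> basic_ball M d s n"
proof -
  interpret Metric_space M d
    using assms(1) by (simp add: computable_metric_space_def)
  \<comment> \<open>The radius of the new ball is lost twice, once between its centre and
    \<open>x\<close> and once in the definition of \<open>far\<close>.\<close>
  let ?e = "(d (s (pfst m)) x - radius m) / 2"
  have "?e > 0" using assms(3) by simp
  then obtain n where n: "x \<in> basic_ball M d s n" "radius n < ?e"
    using dense_basic_ball[OF assms(1,2)] by blast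
  moreover have "s (pfst m) \<in> M"
    using assms(1) by (auto simp: computable_metric_space_def)
  then have "d (s (pfst m)) x \<le> d (s (pfst m)) (s (pfst n)) + d (s (pfst n)) x"
    using n(1) by (intro triangle) (auto simp: basic_ball_eq)
  moreover have "d (s (pfst n)) x < radius n"
    using n(1) by (simp add: basic_ball_eq)
  ultimately have "far d s m n"
    unfolding far_def by argo
  with n(1) show ?thesis by blast
qed

text \<open>Self-maps of \<open>K\<close> can be composed along a word. \<open>J m\<close>
  prescribes only the union of the listed balls within \<open>K\<close>, which leaves room for
  incomplete lists.\<close>

definition effective_map :: "(nat \<Rightarrow> 'm set) \<Rightarrow> 'm set \<Rightarrow> ('m \<Rightarrow> 'm) \<Rightarrow> bool" where
  "effective_map B K f \<longleftrightarrow> f \<in> K \<rightarrow> K \<and>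
    (\<exists>J. semidecidable (\<lambda>z. J (pfst z) (psnd z)) \<and> (\<forall>m. {x \<in> K. f x \<in> B m} = (\<Union>n\<in>{n. J m n}. B n) \<inter> K))"

lemma effective_map_computable_map:
  assumes "computable_map M d s K M d s f" "f \<in> K \<rightarrow> K"
  shows "effective_map (basic_ball M d s) K f"
proof -
  obtain I where I: "re_family I"
    "\<And>m. {x \<in> K. f x \<in> basic_ball M d s m} = (\<Union>n\<in>I m. basic_ball M d s n) \<inter> K"
    using assms(1) unfolding computable_map_def by blast
  have "semidecidable (\<lambda>z. psnd z \<in> I (pfst z))"
    using I(1) by (rule semidecidable_re_family)
  with I(2) assms(2) show ?thesis
    unfolding effective_map_def by (intro conjI exI[of _ "\<lambda>m n. n \<in> I m"]) simp_all
qed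

text \<open>\<open>g\<close> maps the ball \<open>B n\<close> into \<open>B m\<close> as soon as \<open>K\<close> is covered by \<open>B m\<close> together with
  the preimages under \<open>f\<close> of balls that are far from \<open>B n\<close>; compactness makes this sufficient
  condition exhaustive.\<close>

lemma effective_map_inverse:
  assumes cms: "computable_metric_space M d s" and K: "recursively_compact M d s K"
    and f: "effective_map (basic_ball M d s) K f"
    and cont: "continuous_map (subtopology (Metric_space.mtopology M d) K)
      (subtopology (Metric_space.mtopology M d) K) f"
    and g: "g \<in> K \<rightarrow> K" "\<And>x. x \<in> K \<Longrightarrow> f (g x) = x" "\<And>x. x \<in> K \<Longrightarrow> g (f x) = x"
  shows "effective_map (basic_ball M d s) K g"
proof -
  interpret Metric_space M d
    using cms by (simp add: computable_metric_space_def)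
  let ?B = "basic_ball M d s"
  note ms = Metric_space_axioms
  obtain I where I: "semidecidable (\<lambda>z. I (pfst z) (psnd z))"
    "\<And>m. {x \<in> K. f x \<in> ?B m} = (\<Union>n\<in>{n. I m n}. ?B n) \<inter> K"
    using f unfolding effective_map_def by blast
  have fK: "f \<in> K \<rightarrow> K" using f unfolding effective_map_def by blast
  have comp: "compactin mtopology K"
    using K by (simp add: recursively_compact_def)
  then have KM: "K \<subseteq> M"
    using compactin_subset_topspace by fastforce
  define J where "J m n \<longleftrightarrow> (\<exists>c. K \<subseteq> (\<Union>e\<in>set_decode c. ?B e) \<and>
    (\<forall>e\<in>set_decode c. e = m \<or> (\<exists>n'. far d s n n' \<and> I n' e)))" for m n
  have "semidecidable (\<lambda>z. J (pfst z) (psnd z))"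
    unfolding J_def
    by (rule semidecidable_ex semidecidable_conj semidecidable_ball_set_decode semidecidable_disj semidecidable_dec[OF decidable_eq]
        semidecidable_comp[OF semidecidable_cover[OF K]] semidecidable_comp2[OF semidecidable_far[OF cms]] semidecidable_comp2[OF I(1)] computable_basic)+
  moreover have "{x \<in> K. g x \<in> ?B m} = (\<Union>n\<in>{n. J m n}. ?B n) \<inter> K" for m
  proof (intro equalityI subsetI)
    fix x assume "x \<in> (\<Union>n\<in>{n. J m n}. ?B n) \<inter> K"
    then obtain n where n: "J m n" "x \<in> ?B n" "x \<in> K" by blast
    have gx: "g x \<in> K" using g(1) n(3) by blast
    then obtain e where e: "g x \<in> ?B e" "e = m \<or> (\<exists>n'. far d s n n' \<and> I n' e)"
      using n(1) unfolding J_def by blast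
    show "x \<in> {x \<in> K. g x \<in> ?B m}"
      using e(2)
    proof
      assume "\<exists>n'. far d s n n' \<and> I n' e"
      then obtain n' where n': "far d s n n'" "I n' e" by blast
      then have "f (g x) \<in> ?B n'"
        using I(2)[of n'] gx e(1) by blast
      then have "x \<in> ?B n \<inter> ?B n'"
        using g(2) n by simp
      then show ?thesis
        using far_disjoint[OF ms n'(1)] by blast
    qed (use e n in simp)
  next
    fix x assume "x \<in> {x \<in> K. g x \<in> ?B m}"
    then have x: "x \<in> K" "g x \<in> ?B m" by auto
    \<comment> \<open>The image of this set under \<open>f\<close> consists of the points that
      \<open>g\<close> sends outside the ball \<open>m\<close>. It is compact, hence closed, and so
      misses a whole ball around \<open>x\<close>.\<close>
    let ?C = "K - ?B m"
    have "closedin (subtopology mtopology K) (topspace (subtopology mtopology K) - ?B m \<inter> K)"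
      using openin_basic_ball[OF ms] by (intro closedin_diff closedin_topspace openin_subtopology_Int)
    moreover have "topspace (subtopology mtopology K) - ?B m \<inter> K = ?C"
      using KM by auto
    moreover have "compact_space (subtopology mtopology K)"
      using comp by (simp add: compact_space_subtopology)
    ultimately have "compactin (subtopology mtopology K) ?C"
      by (simp add: closedin_compact_space)
    then have "compactin (subtopology mtopology K) (f ` ?C)"
      using image_compactin cont by blast
    then have "closedin mtopology (f ` ?C)"
      using Hausdorff_space_mtopology by (auto simp: compactin_subtopology intro: compactin_imp_closedin)
    moreover have "x \<notin> f ` ?C"
      using g(3) x(2) by auto
    moreover have "x \<in> M" using x(1) KM by blast
    ultimately obtain e where e: "e > 0" "disjnt (f ` ?C) (mball x e)"
      unfolding closedin_metric by blast
    \<comment> \<open>With radius below \<open>e / 2\<close>, every point at distance at least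
      \<open>e\<close> from \<open>x\<close> lies outside the closed ball \<open>n\<close>, as the
      covering by far balls requires.\<close>
    obtain n where n: "x \<in> ?B n" "radius n < e / 2"
      using dense_basic_ball[OF cms, of x "e / 2"] x(1) KM e(1) by auto
    have "radius n < d (s (pfst n)) (f y)" if "y \<in> ?C" for y
    proof -
      have fy: "f y \<in> M" "f y \<notin> mball x e"
        using that e(2) fK KM by (blast, auto simp: disjnt_iff)
      then have "e \<le> d x (f y)"
        using x(1) KM by (auto simp: subset_iff)
      also have "\<dots> \<le> d x (s (pfst n)) + d (s (pfst n)) (f y)"
        using n(1) fy by (intro triangle) (auto simp: basic_ball_eq)
      also have "d x (s (pfst n)) < radius n"
        using n(1) by (simp add: basic_ball_eq commute)
      finally show ?thesis using n(2) by linarith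
    qed
    then have "\<exists>n'. far d s n n' \<and> f y \<in> ?B n'" if "y \<in> ?C" for y
      using exterior_covered_by_far[OF cms, of "f y"] that fK KM by blast
    then have far: "\<exists>n'. far d s n n' \<and> (\<exists>e. I n' e \<and> y \<in> ?B e)" if "y \<in> ?C" for y
      using I(2) that by blast
    have "K \<subseteq> (\<Union>e\<in>{e. e = m \<or> (\<exists>n'. far d s n n' \<and> I n' e)}. ?B e)"
    proof
      fix y assume "y \<in> K"
      then show "y \<in> (\<Union>e\<in>{e. e = m \<or> (\<exists>n'. far d s n n' \<and> I n' e)}. ?B e)"
        using far[of y] by (cases "y \<in> ?B m") auto
    qed
    then obtain F where F: "finite F" "F \<subseteq> {e. e = m \<or> (\<exists>n'. far d s n n' \<and> I n' e)}"
      "K \<subseteq> (\<Union>e\<in>F. ?B e)"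
      using compactin_finite_subcover[OF comp, where B = ?B] openin_basic_ball[OF ms] by meson
    then have "J m n"
      unfolding J_def by (intro exI[of _ "set_encode F"]) auto
    with n x show "x \<in> (\<Union>n\<in>{n. J m n}. ?B n) \<inter> K" by blast
  qed
  ultimately show ?thesis
    unfolding effective_map_def using g(1) by blast
qed

section \<open>Words\<close>

text \<open>The states of the path are pairs of a word and a ball: prepending a letter to the word
  replaces the ball by one of those that exhaust its preimage under that letter.\<close>

lemma effective_map_words:
  assumes "finite L" "\<And>l. l \<in> L \<Longrightarrow> effective_map B K (T l)"
  shows "\<exists>R. semidecidable (\<lambda>z. R (pfst z) (pfst (psnd z)) (psnd (psnd z))) \<and>
    (\<forall>w\<in>lists L. \<forall>m. {x \<in> K. fold T w x \<in> B m} = (\<Union>n\<in>{n. R (list_encode w) m n}. B n) \<inter> K)"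
proof -
  have "\<forall>l\<in>L. \<exists>J. semidecidable (\<lambda>z. J (pfst z) (psnd z)) \<and>
      (\<forall>m. {x \<in> K. T l x \<in> B m} = (\<Union>n\<in>{n. J m n}. B n) \<inter> K)"
    using assms(2) unfolding effective_map_def by blast
  from bchoice[OF this] obtain J where J: "\<And>l. l \<in> L \<Longrightarrow> semidecidable (\<lambda>z. J l (pfst z) (psnd z))"
    "\<And>l m. l \<in> L \<Longrightarrow> {x \<in> K. T l x \<in> B m} = (\<Union>n\<in>{n. J l m n}. B n) \<inter> K"
    by blast
  \<comment> \<open>\<open>Suc (prod_encode (l, c))\<close> is the code of the list with head
    \<open>l\<close> and tail coded by \<open>c\<close>. The empty word has code 0, at which no step
    can end.\<close>
  define step where "step e e' \<longleftrightarrow>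
    (\<exists>l\<in>L. pfst e' = Suc (prod_encode (l, pfst e)) \<and> J l (psnd e) (psnd e'))" for e e'
  define R where "R c m n \<longleftrightarrow> step\<^sup>*\<^sup>* (prod_encode (0, m)) (prod_encode (c, n))" for c m n
  have "semidecidable (\<lambda>z. step (pfst (psnd z)) (psnd (psnd z)))"
    unfolding step_def
    by (intro semidecidable_bex_finite[OF assms(1)] semidecidable_conj semidecidable_dec[OF decidable_eq] semidecidable_comp2[OF J(1)] computable_basic)
  then have semidecidable: "semidecidable (\<lambda>z. R (pfst z) (pfst (psnd z)) (psnd (psnd z)))"
    unfolding R_def by (rule semidecidable_rtranclp[where J = "\<lambda>_. step"]) (rule computable_basic)+
  have R_Nil: "R (list_encode []) m n \<longleftrightarrow> n = m" for m n
  proof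
    assume "R (list_encode []) m n"
    then have "step\<^sup>*\<^sup>* (prod_encode (0, m)) (prod_encode (0, n))"
      by (simp add: R_def)
    then show "n = m"
      by (cases rule: rtranclp.cases) (auto simp: step_def)
  qed (simp add: R_def)
  \<comment> \<open>\<open>fold\<close> applies the head letter first, so the preimage under
    \<open>l # w\<close> is the preimage under \<open>T l\<close> of the preimage under
    \<open>w\<close>: the head letter is the last step of the path.\<close>
  have R_Cons: "R (list_encode (l # w)) m n \<longleftrightarrow> (\<exists>n'. R (list_encode w) m n' \<and> J l n' n)"
    if "l \<in> L" for l w m n
  proof
    assume "R (list_encode (l # w)) m n"
    then have "step\<^sup>*\<^sup>* (prod_encode (0, m)) (prod_encode (list_encode (l # w), n))"
      by (simp only: R_def)
    then obtain e where e: "step\<^sup>*\<^sup>* (prod_encode (0, m)) e" "step e (prod_encode (list_encode (l # w), n))"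
      by (cases rule: rtranclp.cases) auto
    from e(2) have "pfst e = list_encode w" "J l (psnd e) n"
      unfolding step_def by auto
    with e(1) show "\<exists>n'. R (list_encode w) m n' \<and> J l n' n"
      unfolding R_def by (metis pair_pfst_psnd)
  next
    assume "\<exists>n'. R (list_encode w) m n' \<and> J l n' n"
    then obtain n' where "R (list_encode w) m n'" "J l n' n" by blast
    moreover from this(2) have "step (prod_encode (list_encode w, n')) (prod_encode (list_encode (l # w), n))"
      using that by (auto simp: step_def)
    ultimately show "R (list_encode (l # w)) m n"
      unfolding R_def by (meson rtranclp.rtrancl_into_rtrancl)
  qed
  have "{x \<in> K. fold T w x \<in> B m} = (\<Union>n\<in>{n. R (list_encode w) m n}. B n) \<inter> K" if "w \<in> lists L" for w m
    using that
  proof (induction w)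
    case Nil
    show ?case unfolding R_Nil by auto
  next
    case (Cons l w)
    have TK: "T l x \<in> K" if "x \<in> K" for x
      using assms(2)[OF \<open>l \<in> L\<close>] that unfolding effective_map_def by blast
    show ?case
    proof (rule Set.set_eqI)
      fix x
      have "x \<in> {x \<in> K. fold T (l # w) x \<in> B m} \<longleftrightarrow> x \<in> K \<and> T l x \<in> {x \<in> K. fold T w x \<in> B m}"
        using TK by auto
      also have "\<dots> \<longleftrightarrow> (\<exists>n'. R (list_encode w) m n' \<and> x \<in> {x \<in> K. T l x \<in> B n'})"
        unfolding Cons.IH using TK by blast
      also have "\<dots> \<longleftrightarrow> x \<in> (\<Union>n\<in>{n. R (list_encode (l # w)) m n}. B n) \<inter> K"
        unfolding J(2)[OF \<open>l \<in> L\<close>] R_Cons[OF \<open>l \<in> L\<close>] by blast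
      finally show "x \<in> {x \<in> K. fold T (l # w) x \<in> B m} \<longleftrightarrow>
          x \<in> (\<Union>n\<in>{n. R (list_encode (l # w)) m n}. B n) \<inter> K" .
    qed
  qed
  with semidecidable show ?thesis by blast
qed

section \<open>Pattern codes\<close>

definition letter_code :: "nat \<times> bool \<Rightarrow> nat" where
  "letter_code l = 2 * fst l + of_bool (snd l)"

lemma letter_code_inverse: "(letter_code l div 2, odd (letter_code l)) = l"
  by (cases l) (simp add: letter_code_def)

lemma letter_code_decode: "letter_code (l div 2, odd l) = l"
  by (simp add: letter_code_def)

lemma fword_encode_eq: "fword_encode w = list_encode (map letter_code w)"
  unfolding fword_encode_def letter_code_def by (simp add: case_prod_unfold)

lemma inj_fword_encode: "inj fword_encode"
proof -
  have "inj letter_code"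
    by (rule inj_on_inverseI) (rule letter_code_inverse)
  then show ?thesis
    unfolding fword_encode_eq[abs_def] by (auto intro!: injI simp: list_encode_eq inj_map_eq_map)
qed

lemma letters_free_group_words:
  assumes "w \<in> free_group_words k"
  shows "map letter_code w \<in> lists {..<2 * k}"
proof -
  have "letter_code l < 2 * k" if "l \<in> set w" for l
    using assms that unfolding free_group_words_def letter_code_def by (cases l) (fastforce simp: of_bool_def)
  then show ?thesis by (auto simp: in_lists_conv_set)
qed

text \<open>Being reduced is a condition on adjacent letters and passes to tails, so the reduced
  words are those reached from the empty word by prepending admissible letters.\<close>

lemma semidecidable_fword_code:
  assumes "computable f"
  shows "semidecidable (\<lambda>x. f x \<in> fword_encode ` free_group_words k)"
proof -
  \<comment> \<open>For a nonempty word code \<open>c\<close>, \<open>pfst (c - 1)\<close> is its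
    head letter. A new letter may have a different generator or equal the head, which excludes
    exactly cancellation.\<close>
  define step where "step c c' \<longleftrightarrow> (\<exists>l\<in>{..<2 * k}. c' = Suc (prod_encode (l, c)) \<and>
    (c = 0 \<or> l div 2 \<noteq> pfst (c - 1) div 2 \<or> l = pfst (c - 1)))" for c c'
  have ok: "l div 2 \<noteq> letter_code m div 2 \<or> l = letter_code m \<longleftrightarrow>
      (case (l div 2, odd l) of (i, b) \<Rightarrow> \<lambda>(j, c). i = j \<longrightarrow> b = c) m" for l m
  proof -
    obtain j c where "m = (j, c)" by fastforce
    then show ?thesis
      by (cases c; simp add: letter_code_def; presburger)
  qed
  have step_iff: "step (fword_encode w) c \<longleftrightarrow>
      (\<exists>l. c = fword_encode (l # w) \<and> l # w \<in> free_group_words k)"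
    if "w \<in> free_group_words k" for w c
  proof -
    have mem: "(l div 2, odd l) # w \<in> free_group_words k \<longleftrightarrow>
       l < 2 * k \<and> (fword_encode w = 0 \<or> l div 2 \<noteq> pfst (fword_encode w - 1) div 2 \<or>
        l = pfst (fword_encode w - 1))" for l
      using that ok[of l]
      by (cases w) (auto simp: free_group_words_def fword_encode_eq simp del: split_paired_All)
    have "step (fword_encode w) c \<longleftrightarrow>
        (\<exists>l. c = fword_encode ((l div 2, odd l) # w) \<and> (l div 2, odd l) # w \<in> free_group_words k)"
      unfolding mem step_def by (auto simp: fword_encode_eq letter_code_decode)
    then show ?thesis
      by (metis letter_code_inverse)
  qed
  have "step\<^sup>*\<^sup>* 0 c \<longleftrightarrow> c \<in> fword_encode ` free_group_words k" for c
  proof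
    assume "step\<^sup>*\<^sup>* 0 c"
    then show "c \<in> fword_encode ` free_group_words k"
    proof (induction rule: rtranclp_induct)
      case base
      have "0 = fword_encode []" "[] \<in> free_group_words k"
        by (simp_all add: fword_encode_eq free_group_words_def)
      then show ?case by blast
    next
      case (step c c')
      then show ?case using step_iff by blast
    qed
  next
    have "step\<^sup>*\<^sup>* 0 (fword_encode w)" if "w \<in> free_group_words k" for w
      using that
    proof (induction w)
      case (Cons l w)
      then have "w \<in> free_group_words k"
        by (cases w) (auto simp: free_group_words_def)
      with Cons have "step\<^sup>*\<^sup>* 0 (fword_encode w)" "step (fword_encode w) (fword_encode (l # w))"
        using step_iff by blast+
      then show ?case by (rule rtranclp.rtrancl_into_rtrancl)
    qed (simp add: fword_encode_eq)
    then show "c \<in> fword_encode ` free_group_words k \<Longrightarrow> step\<^sup>*\<^sup>* 0 c"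
      by blast
  qed
  moreover have "semidecidable (\<lambda>x. step (pfst (psnd x)) (psnd (psnd x)))"
    unfolding step_def
    by (intro semidecidable_bex_finite semidecidable_dec decidable_conj decidable_disj decidable_not decidable_eq computable_halfI computable_basic) simp
  then have "semidecidable (\<lambda>x. step\<^sup>*\<^sup>* 0 (f x))"
    by (rule semidecidable_rtranclp[where J = "\<lambda>_. step"]) (rule computable_const assms)+
  ultimately show ?thesis by simp
qed

section \<open>Patterns as coded finite graphs\<close>

definition pattern_graph :: "(fword \<rightharpoonup> nat) \<Rightarrow> nat set" where
  "pattern_graph p = {prod_encode (fword_encode w, a) | w a. p w = Some a}"

lemma set_decode_pattern_encode:
  assumes "p \<in> patterns k A"
  shows "set_decode (pattern_encode p) = pattern_graph p"
proof -
  have "pattern_graph p = (\<lambda>w. prod_encode (fword_encode w, the (p w))) ` dom p"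
    by (force simp: pattern_graph_def)
  then have "finite (pattern_graph p)"
    using assms by (simp add: patterns_def)
  then show ?thesis
    by (simp add: pattern_encode_def pattern_graph_def)
qed

text \<open>Every number codes a finite set, so being a pattern code means that this set is the
  graph of a function on reduced words with values in \<open>A\<close>. Phrased on elements of the
  set, this can be tested without reconstructing the pattern.\<close>

lemma mem_pattern_codes_iff:
  "P \<in> pattern_encode ` patterns k A \<longleftrightarrow>
    (\<forall>e\<in>set_decode P. psnd e \<in> A \<and> pfst e \<in> fword_encode ` free_group_words k) \<and>
    (\<forall>e\<in>set_decode P. \<forall>e'\<in>set_decode P. pfst e = pfst e' \<longrightarrow> e = e')"
  (is "_ \<longleftrightarrow> ?R")
proof
  assume "P \<in> pattern_encode ` patterns k A"
  then obtain p where p: "p \<in> patterns k A" "P = pattern_encode p" by blast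
  have graph: thesis if e: "e \<in> set_decode P"
    and that: "\<And>w a. e = prod_encode (fword_encode w, a) \<Longrightarrow> p w = Some a \<Longrightarrow> a \<in> A \<Longrightarrow> w \<in> free_group_words k \<Longrightarrow> thesis"
    for e thesis
  proof -
    obtain w a where wa: "e = prod_encode (fword_encode w, a)" "p w = Some a"
      using e unfolding p(2) set_decode_pattern_encode[OF p(1)] by (auto simp: pattern_graph_def)
    then have "a \<in> A" "w \<in> free_group_words k"
      using p(1) by (auto simp: patterns_def intro: ranI)
    with wa that show ?thesis by blast
  qed
  show ?R
  proof (intro conjI ballI impI)
    fix e assume "e \<in> set_decode P"
    then obtain w a where "e = prod_encode (fword_encode w, a)" "a \<in> A" "w \<in> free_group_words k"
      by (rule graph)
    then show "psnd e \<in> A" "pfst e \<in> fword_encode ` free_group_words k"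
      by simp_all
  next
    fix e e' assume e: "e \<in> set_decode P" "e' \<in> set_decode P" "pfst e = pfst e'"
    from e(1) obtain w a where 1: "e = prod_encode (fword_encode w, a)" "p w = Some a"
      by (rule graph)
    from e(2) obtain w' a' where 2: "e' = prod_encode (fword_encode w', a')" "p w' = Some a'"
      by (rule graph)
    from e(3) 1(1) 2(1) have "w = w'"
      using inj_fword_encode by (simp add: inj_eq)
    with 1 2 show "e = e'" by simp
  qed
next
  assume R: ?R
  define E where "E = set_decode P"
  have RA: "psnd e \<in> A" "pfst e \<in> fword_encode ` free_group_words k" if "e \<in> E" for e
    using R that unfolding E_def by blast+
  have RF: "e = e'" if "e \<in> E" "e' \<in> E" "pfst e = pfst e'" for e e'
    using R that unfolding E_def by blast
  define p where "p w = (if \<exists>a. prod_encode (fword_encode w, a) \<in> E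
    then Some (SOME a. prod_encode (fword_encode w, a) \<in> E) else None)" for w
  have p_iff: "p w = Some a \<longleftrightarrow> prod_encode (fword_encode w, a) \<in> E" for w a
  proof (cases "\<exists>a. prod_encode (fword_encode w, a) \<in> E")
    case True
    define a' where "a' = (SOME a. prod_encode (fword_encode w, a) \<in> E)"
    have a': "prod_encode (fword_encode w, a') \<in> E"
      unfolding a'_def by (rule someI_ex[OF True])
    have "p w = Some a'"
      using True by (simp add: p_def a'_def)
    moreover have "a = a'" if "prod_encode (fword_encode w, a) \<in> E"
      using RF[OF that a'] by simp
    ultimately show ?thesis using a' by auto
  next
    case False
    then show ?thesis by (simp add: p_def)
  qed
  have "fword_encode w \<in> pfst ` E" if "w \<in> dom p" for w
  proof -
    from that obtain a where "p w = Some a" by blast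
    then have "prod_encode (fword_encode w, a) \<in> E" by (simp only: p_iff)
    then show ?thesis by (rule rev_image_eqI) simp
  qed
  then have "fword_encode ` dom p \<subseteq> pfst ` E" by blast
  then have "finite (fword_encode ` dom p)"
    by (rule finite_subset) (simp add: E_def)
  then have "finite (dom p)"
    by (rule finite_imageD) (rule inj_on_subset[OF inj_fword_encode subset_UNIV])
  moreover have "w \<in> free_group_words k" "a \<in> A" if "p w = Some a" for w a
    using RA[of "prod_encode (fword_encode w, a)"] that
    by (simp_all add: p_iff inj_image_mem_iff[OF inj_fword_encode])
  ultimately have p: "p \<in> patterns k A"
    by (auto simp: patterns_def ran_def)
  have "e \<in> pattern_graph p" if "e \<in> E" for e
  proof -
    obtain w where "pfst e = fword_encode w"
      using RA(2) \<open>e \<in> E\<close> by blast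
    then have e: "prod_encode (fword_encode w, psnd e) = e"
      by (simp flip: \<open>pfst e = fword_encode w\<close>)
    then have "p w = Some (psnd e)"
      using that by (simp only: p_iff)
    with e[symmetric] show ?thesis
      unfolding pattern_graph_def mem_Collect_eq by (intro exI conjI)
  qed
  moreover have "pattern_graph p \<subseteq> E"
    unfolding pattern_graph_def p_iff by blast
  ultimately have "pattern_graph p = E" by blast
  \<comment> \<open>Canonical indices are unique, so equality of the coded sets yields equality of
    the codes.\<close>
  then have "set_encode (set_decode (pattern_encode p)) = set_encode (set_decode P)"
    by (simp only: set_decode_pattern_encode[OF p] E_def)
  then have "P = pattern_encode p" by simp
  with p show "P \<in> pattern_encode ` patterns k A" by blast
qed

text \<open>A pattern fails iff each point of \<open>K\<close> violates some entry
  \<open>(w, a)\<close>, that is, \<open>w\<close> carries it into a ball of \<open>L a\<close>.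
  These points form a union of balls enumerable from the code of \<open>w\<close>. Compactness makes
  finitely many of the balls cover \<open>K\<close> as soon as all do, so the search for a finite
  cover is exhaustive.\<close>

lemma re_set_forbidden_patterns:
  assumes cover: "semidecidable (\<lambda>c. K \<subseteq> (\<Union>n\<in>set_decode c. B n))"
    and K: "compactin X K" and B: "\<And>n. openin X (B n)"
    and T: "\<And>l. l < 2 * k \<Longrightarrow> effective_map B K (T l)"
    and A: "finite A"
    and L: "\<And>a. a \<in> A \<Longrightarrow> finite (L a)" "\<And>a. a \<in> A \<Longrightarrow> K - Q a = K \<inter> (\<Union>m\<in>L a. B m)"
  shows "re_set (pattern_encode ` {p \<in> patterns k A.
    \<not> (\<exists>x\<in>K. \<forall>w\<in>dom p. fold T (map letter_code w) x \<in> Q (the (p w)))})"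
proof -
  have "\<exists>R. semidecidable (\<lambda>z. R (pfst z) (pfst (psnd z)) (psnd (psnd z))) \<and> (\<forall>w\<in>lists {..<2 * k}. \<forall>m.
      {x \<in> K. fold T w x \<in> B m} = (\<Union>n\<in>{n. R (list_encode w) m n}. B n) \<inter> K)"
    by (rule effective_map_words) (simp_all add: T)
  then obtain R where R: "semidecidable (\<lambda>z. R (pfst z) (pfst (psnd z)) (psnd (psnd z)))"
    "\<forall>w\<in>lists {..<2 * k}. \<forall>m.
      {x \<in> K. fold T w x \<in> B m} = (\<Union>n\<in>{n. R (list_encode w) m n}. B n) \<inter> K"
    by (elim exE conjE) (rule that)
  \<comment> \<open>The lists \<open>L a\<close> merged into one finite set, decidable because it is
    a constant of the algorithm.\<close>
  define L' where "L' = (\<Union>a\<in>A. (\<lambda>m. prod_encode (a, m)) ` L a)"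
  have finL': "finite L'"
    unfolding L'_def using A L(1) by (intro finite_UN_I finite_imageI)
  have L': "prod_encode (a, m) \<in> L' \<longleftrightarrow> m \<in> L a" if "a \<in> A" for a m
    using that unfolding L'_def by auto
  \<comment> \<open>Formulated for arbitrary codes \<open>P\<close>; whether \<open>P\<close> codes
    a pattern is tested separately.\<close>
  define C where "C P \<longleftrightarrow> (\<exists>c. K \<subseteq> (\<Union>n\<in>set_decode c. B n) \<and> (\<forall>n\<in>set_decode c. \<exists>e\<in>set_decode P.
    \<exists>m. prod_encode (psnd e, m) \<in> L' \<and> R (pfst e) m n))" for P
  have foldK: "fold T w x \<in> K" if "w \<in> lists {..<2 * k}" "x \<in> K" for w x
  proof -
    have "T l x \<in> K" if "l < 2 * k" "x \<in> K" for l x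
      using T[OF that(1)] that(2) unfolding effective_map_def by blast
    with that show ?thesis by (induction w arbitrary: x) auto
  qed
  have "C (pattern_encode p) \<longleftrightarrow> \<not> (\<exists>x\<in>K. \<forall>w\<in>dom p. fold T (map letter_code w) x \<in> Q (the (p w)))"
    if p: "p \<in> patterns k A" for p
  proof -
    have words: "map letter_code w \<in> lists {..<2 * k}" "a \<in> A" if "p w = Some a" for w a
    proof -
      have "w \<in> free_group_words k" "a \<in> A"
        using p that by (auto simp: patterns_def intro: ranI)
      then show "map letter_code w \<in> lists {..<2 * k}" "a \<in> A"
        by (simp_all only: letters_free_group_words)
    qed
    \<comment> \<open>The balls on which the violation of some entry of \<open>p\<close> is
      certified.\<close>
    define N where "N = {n. \<exists>w a m. p w = Some a \<and> m \<in> L a \<and> R (fword_encode w) m n}"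
    have N: "n \<in> N \<longleftrightarrow> (\<exists>e\<in>pattern_graph p. \<exists>m. prod_encode (psnd e, m) \<in> L' \<and> R (pfst e) m n)" for n
    proof
      assume "n \<in> N"
      then obtain w a m where wam: "p w = Some a" "m \<in> L a" "R (fword_encode w) m n"
        unfolding N_def by blast
      then have "prod_encode (fword_encode w, a) \<in> pattern_graph p"
        unfolding pattern_graph_def by blast
      moreover have "prod_encode (psnd (prod_encode (fword_encode w, a)), m) \<in> L'"
        "R (pfst (prod_encode (fword_encode w, a))) m n"
        using wam L' words(2)[OF wam(1)] by simp_all
      ultimately show "\<exists>e\<in>pattern_graph p. \<exists>m. prod_encode (psnd e, m) \<in> L' \<and> R (pfst e) m n"
        by blast
    next
      assume "\<exists>e\<in>pattern_graph p. \<exists>m. prod_encode (psnd e, m) \<in> L' \<and> R (pfst e) m n"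
      then obtain w a m where wam: "p w = Some a" "prod_encode (a, m) \<in> L'" "R (fword_encode w) m n"
        unfolding pattern_graph_def by auto
      then have "m \<in> L a" using L' words(2)[OF wam(1)] by blast
      with wam show "n \<in> N" unfolding N_def by blast
    qed
    have viol: "fold T (map letter_code w) x \<notin> Q a \<longleftrightarrow> (\<exists>n m. x \<in> B n \<and> m \<in> L a \<and> R (fword_encode w) m n)"
      if "p w = Some a" "x \<in> K" for w a x
    proof -
      note w = words[OF that(1)]
      have "fold T (map letter_code w) x \<notin> Q a \<longleftrightarrow> fold T (map letter_code w) x \<in> K - Q a"
        using foldK[OF w(1) that(2)] by blast
      also have "\<dots> \<longleftrightarrow> (\<exists>m\<in>L a. x \<in> {x \<in> K. fold T (map letter_code w) x \<in> B m})"
        unfolding L(2)[OF w(2)] using foldK[OF w(1) that(2)] that(2) by blast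
      also have "\<dots> \<longleftrightarrow> (\<exists>n m. x \<in> B n \<and> m \<in> L a \<and> R (fword_encode w) m n)"
        unfolding R(2)[rule_format, OF w(1)] fword_encode_eq using that(2) by blast
      finally show ?thesis .
    qed
    have "(\<exists>w\<in>dom p. fold T (map letter_code w) x \<notin> Q (the (p w))) \<longleftrightarrow> x \<in> (\<Union>n\<in>N. B n)"
      if x: "x \<in> K" for x
    proof
      assume "\<exists>w\<in>dom p. fold T (map letter_code w) x \<notin> Q (the (p w))"
      then obtain w a where w: "p w = Some a" "fold T (map letter_code w) x \<notin> Q a" by auto
      then obtain n m where "x \<in> B n" "m \<in> L a" "R (fword_encode w) m n"
        using viol[OF w(1) x] by blast
      with w(1) show "x \<in> (\<Union>n\<in>N. B n)" unfolding N_def by blast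
    next
      assume "x \<in> (\<Union>n\<in>N. B n)"
      then obtain n w a m where w: "x \<in> B n" "p w = Some a" "m \<in> L a" "R (fword_encode w) m n"
        unfolding N_def by blast
      then have "fold T (map letter_code w) x \<notin> Q (the (p w))"
        using viol[OF w(2) x] by auto
      with w(2) show "\<exists>w\<in>dom p. fold T (map letter_code w) x \<notin> Q (the (p w))" by blast
    qed
    then have "\<not> (\<exists>x\<in>K. \<forall>w\<in>dom p. fold T (map letter_code w) x \<in> Q (the (p w))) \<longleftrightarrow> K \<subseteq> (\<Union>n\<in>N. B n)"
      unfolding subset_iff by blast
    also have "\<dots> \<longleftrightarrow> (\<exists>F. finite F \<and> F \<subseteq> N \<and> K \<subseteq> (\<Union>n\<in>F. B n))"
    proof
      assume "K \<subseteq> (\<Union>n\<in>N. B n)"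
      then show "\<exists>F. finite F \<and> F \<subseteq> N \<and> K \<subseteq> (\<Union>n\<in>F. B n)"
        by (rule compactin_finite_subcover[OF K B])
    qed blast
    also have "\<dots> \<longleftrightarrow> (\<exists>c. set_decode c \<subseteq> N \<and> K \<subseteq> (\<Union>n\<in>set_decode c. B n))"
    proof
      assume "\<exists>F. finite F \<and> F \<subseteq> N \<and> K \<subseteq> (\<Union>n\<in>F. B n)"
      then obtain F where "finite F" "F \<subseteq> N" "K \<subseteq> (\<Union>n\<in>F. B n)" by blast
      then show "\<exists>c. set_decode c \<subseteq> N \<and> K \<subseteq> (\<Union>n\<in>set_decode c. B n)"
        by (intro exI[of _ "set_encode F"]) simp
    qed (use finite_set_decode in blast)
    also have "\<dots> \<longleftrightarrow> C (pattern_encode p)"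
    proof -
      have "set_decode c \<subseteq> N \<longleftrightarrow> (\<forall>n\<in>set_decode c. n \<in> N)" for c by blast
      then show ?thesis
        unfolding C_def set_decode_pattern_encode[OF p] N by (simp only: conj_commute)
    qed
    finally show ?thesis by (rule sym)
  qed
  then have "pattern_encode ` {p \<in> patterns k A.
      \<not> (\<exists>x\<in>K. \<forall>w\<in>dom p. fold T (map letter_code w) x \<in> Q (the (p w)))} =
    pattern_encode ` {p \<in> patterns k A. C (pattern_encode p)}"
    by (intro arg_cong[where f = "image pattern_encode"] Collect_cong conj_cong refl) (rule sym)
  also have "\<dots> = {P. P \<in> pattern_encode ` patterns k A \<and> C P}"
    by blast
  finally have eq: "pattern_encode ` {p \<in> patterns k A.
      \<not> (\<exists>x\<in>K. \<forall>w\<in>dom p. fold T (map letter_code w) x \<in> Q (the (p w)))} =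
    {P. P \<in> pattern_encode ` patterns k A \<and> C P}" .
  have R': "semidecidable (\<lambda>x. R (f x) (g x) (h x))" if "computable f" "computable g" "computable h" for f g h
    using semidecidable_comp[OF R(1) computable_pairI[OF that(1) computable_pairI[OF that(2,3)]]]
    by (simp only: pfst_pair psnd_pair)
  have "semidecidable C"
    unfolding C_def[abs_def]
    by (intro semidecidable_ex semidecidable_conj semidecidable_comp[OF cover] semidecidable_ball_set_decode semidecidable_bex_set_decode R'
        semidecidable_dec[OF decidable_finite[OF finL']] computable_basic)
  \<comment> \<open>The implication expressing functionality becomes a disjunction, whose negated
    premise is still decidable.\<close>
  then have "semidecidable (\<lambda>P. P \<in> pattern_encode ` patterns k A \<and> C P)"
    unfolding mem_pattern_codes_iff imp_conv_disj
    by (intro semidecidable_conj semidecidable_ball_set_decode semidecidable_disj semidecidable_fword_code semidecidable_dec[OF decidable_finite[OF A]]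
        semidecidable_dec[OF decidable_not] semidecidable_dec[OF decidable_eq] decidable_eq computable_basic)
  then show ?thesis
    unfolding re_set_iff_sig eq by simp
qed

section \<open>Coding subshifts\<close>

definition part_of :: "nat \<Rightarrow> (nat \<Rightarrow> 'y set) \<Rightarrow> 'y \<Rightarrow> nat" where
  "part_of n P y = (THE i. i \<in> {1..n} \<and> y \<in> P i)"

lemma part_of_eq:
  assumes "clopen_partition Y n P" "i \<in> {1..n}" "y \<in> P i"
  shows "part_of n P y = i"
  unfolding part_of_def
proof (rule the_equality)
  show "j = i" if "j \<in> {1..n} \<and> y \<in> P j" for j
    using assms that unfolding clopen_partition_def disjoint_family_on_def by blast
qed (use assms in blast)

lemma part_of_mem:
  assumes "clopen_partition Y n P" "y \<in> topspace Y"
  shows "part_of n P y \<in> {1..n}" "y \<in> P (part_of n P y)"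
proof -
  obtain i where "i \<in> {1..n}" "y \<in> P i"
    using assms unfolding clopen_partition_def by blast
  with part_of_eq[OF assms(1) this] show "part_of n P y \<in> {1..n}" "y \<in> P (part_of n P y)"
    by simp_all
qed

lemma continuous_map_part_of:
  assumes "clopen_partition Y n P"
  shows "continuous_map Y (discrete_topology {1..n}) (part_of n P)"
  unfolding continuous_map_def openin_discrete_topology topspace_discrete_topology
proof (intro conjI allI impI)
  show "part_of n P \<in> topspace Y \<rightarrow> {1..n}"
    using part_of_mem[OF assms] by blast
  fix U assume U: "U \<subseteq> {1..n}"
  have "{y \<in> topspace Y. part_of n P y \<in> U} = (\<Union>i\<in>U. P i)"
  proof (intro equalityI subsetI)
    fix y assume "y \<in> (\<Union>i\<in>U. P i)"
    then obtain i where i: "i \<in> U" "y \<in> P i" by blast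
    then have "part_of n P y = i" "y \<in> topspace Y"
      using U part_of_eq[OF assms, of i y] assms unfolding clopen_partition_def by blast+
    with i show "y \<in> {y \<in> topspace Y. part_of n P y \<in> U}" by simp
  qed (use part_of_mem[OF assms] in blast)
  moreover have "openin Y (\<Union>i\<in>U. P i)"
    using assms U unfolding clopen_partition_def by (intro openin_Union) blast
  ultimately show "openin Y {y \<in> topspace Y. part_of n P y \<in> U}" by simp
qed

definition itinerary ::
  "('g, 'b) monoid_scheme \<Rightarrow> ('g \<Rightarrow> 'y \<Rightarrow> 'y) \<Rightarrow> nat \<Rightarrow> (nat \<Rightarrow> 'y set) \<Rightarrow> 'y \<Rightarrow> 'g \<Rightarrow> nat" where
  "itinerary G \<psi> n P y = (\<lambda>g\<in>carrier G. part_of n P (\<psi> (inv\<^bsub>G\<^esub> g) y))"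

lemma top_action_closed:
  assumes "top_action G Y \<psi>" "g \<in> carrier G" "y \<in> topspace Y"
  shows "\<psi> g y \<in> topspace Y"
  using assms homeomorphic_imp_surjective_map unfolding top_action_def by blast

text \<open>Each point lies in exactly one part, so a point determines its coding. Presenting the
  subshift as an image makes compactness and equivariance applicable.\<close>

lemma coding_subshift_eq:
  assumes "group G" "top_action G Y \<psi>" "clopen_partition Y n P"
  shows "coding_subshift G Y \<psi> n P = itinerary G \<psi> n P ` topspace Y"
proof (intro equalityI subsetI)
  interpret group G by fact
  fix z assume "z \<in> coding_subshift G Y \<psi> n P"
  then have zP: "z \<in> carrier G \<rightarrow>\<^sub>E {1..n}"
    and "\<exists>y\<in>topspace Y. \<forall>g\<in>carrier G. \<psi> (inv\<^bsub>G\<^esub> g) y \<in> P (z g)"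
    unfolding coding_subshift_def mem_Collect_eq by (rule conjunct1, rule conjunct2)
  from this(2) obtain y where y: "y \<in> topspace Y" "\<forall>g\<in>carrier G. \<psi> (inv\<^bsub>G\<^esub> g) y \<in> P (z g)"
    by (rule bexE)
  have "z g = itinerary G \<psi> n P y g" for g
  proof (cases "g \<in> carrier G")
    case True
    have "z g \<in> {1..n}" using zP True by (rule PiE_mem)
    from part_of_eq[OF assms(3) this bspec[OF y(2) True]] True show ?thesis
      by (simp add: itinerary_def)
  next
    case False
    with PiE_arb[OF zP False] show ?thesis by (simp add: itinerary_def)
  qed
  then have "z = itinerary G \<psi> n P y" by (rule ext)
  with y(1) show "z \<in> itinerary G \<psi> n P ` topspace Y" by blast
next
  interpret group G by fact
  fix z assume "z \<in> itinerary G \<psi> n P ` topspace Y"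
  then obtain y where y: "y \<in> topspace Y" "z = itinerary G \<psi> n P y" by blast
  have closed: "\<psi> (inv\<^bsub>G\<^esub> g) y \<in> topspace Y" if "g \<in> carrier G" for g
    using top_action_closed[OF assms(2) inv_closed[OF that] y(1)] .
  have "z \<in> carrier G \<rightarrow>\<^sub>E {1..n}"
    unfolding y(2) itinerary_def restrict_PiE_iff using part_of_mem(1)[OF assms(3) closed] by blast
  moreover have "\<psi> (inv\<^bsub>G\<^esub> g) y \<in> P (z g)" if "g \<in> carrier G" for g
    using part_of_mem(2)[OF assms(3) closed[OF that]] that by (simp add: y(2) itinerary_def)
  ultimately show "z \<in> coding_subshift G Y \<psi> n P"
    unfolding coding_subshift_def mem_Collect_eq using y(1) by (intro conjI bexI ballI)
qed

text \<open>Closed as a continuous image of a compact space in a Hausdorff space; invariant because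
  shifting an itinerary by \<open>g\<close> gives the itinerary of
  \<open>\<psi> g y\<close>.\<close>

lemma subshift_coding_subshift:
  assumes "group G" "top_action G Y \<psi>" "clopen_partition Y n P"
  shows "subshift G {1..n} (coding_subshift G Y \<psi> n P)"
  unfolding subshift_def
proof (intro conjI ballI)
  interpret group G by fact
  interpret group_action G "topspace Y" \<psi>
    using assms(2) by (simp add: top_action_def)
  let ?Z = "product_topology (\<lambda>_. discrete_topology {1..n}) (carrier G)"
  have "continuous_map Y (discrete_topology {1..n}) (\<lambda>y. itinerary G \<psi> n P y g)" if "g \<in> carrier G" for g
  proof -
    have "continuous_map Y Y (\<psi> (inv\<^bsub>G\<^esub> g))"
      using assms(2) inv_closed[OF that] unfolding top_action_def
      by (blast intro: homeomorphic_imp_continuous_map)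
    from continuous_map_compose[OF this continuous_map_part_of[OF assms(3)]] show ?thesis
      using that by (simp add: itinerary_def o_def)
  qed
  then have "continuous_map Y ?Z (itinerary G \<psi> n P)"
    unfolding continuous_map_componentwise by (auto simp: itinerary_def)
  moreover have "compactin Y (topspace Y)"
    using assms(2) by (simp add: top_action_def compact_space_def)
  ultimately have "compactin ?Z (coding_subshift G Y \<psi> n P)"
    unfolding coding_subshift_eq[OF assms] by (intro image_compactin)
  moreover have "Hausdorff_space ?Z"
    by (simp add: Hausdorff_space_product_topology)
  ultimately show "closedin ?Z (coding_subshift G Y \<psi> n P)"
    by (blast intro: compactin_imp_closedin)
  fix g z assume g: "g \<in> carrier G" and "z \<in> coding_subshift G Y \<psi> n P"
  then obtain y where y: "y \<in> topspace Y" "z = itinerary G \<psi> n P y"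
    unfolding coding_subshift_eq[OF assms] by blast
  have "shift G g z h = itinerary G \<psi> n P (\<psi> g y) h" for h
  proof (cases "h \<in> carrier G")
    case True
    with g have "\<psi> (inv\<^bsub>G\<^esub> h) (\<psi> g y) = \<psi> (inv\<^bsub>G\<^esub> (inv\<^bsub>G\<^esub> g \<otimes>\<^bsub>G\<^esub> h)) y"
      by (simp add: inv_mult_group composition_rule[OF y(1)])
    with g True show ?thesis
      by (simp add: shift_def itinerary_def y(2))
  qed (simp add: shift_def itinerary_def)
  then have "shift G g z = itinerary G \<psi> n P (\<psi> g y)" by (rule ext)
  then show "shift G g z \<in> coding_subshift G Y \<psi> n P"
    unfolding coding_subshift_eq[OF assms] using top_action_closed[OF assms(2) g y(1)] by blast
qed simp

text \<open>Balls inside an open set that traces out \<open>C\<close> cover \<open>C\<close>, and a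
  finite subcover remains inside that set, so its trace on \<open>K\<close> is again
  \<open>C\<close>. This turns topological information into finite data.\<close>

lemma clopen_eq_finite_union_balls:
  assumes cms: "computable_metric_space M d s" and KM: "K \<subseteq> M"
    and C: "compactin (Metric_space.mtopology M d) C"
    and op: "openin (subtopology (Metric_space.mtopology M d) K) C"
  shows "\<exists>L. finite L \<and> C = K \<inter> (\<Union>m\<in>L. basic_ball M d s m)"
proof -
  interpret Metric_space M d
    using cms by (simp add: computable_metric_space_def)
  let ?B = "basic_ball M d s"
  note ms = Metric_space_axioms
  obtain U where U: "openin mtopology U" "C = U \<inter> K"
    using op unfolding openin_subtopology by blast
  define S where "S = {m. ?B m \<subseteq> U}"
  have "\<exists>m\<in>S. x \<in> ?B m" if "x \<in> C" for x
  proof -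
    have x: "x \<in> U" "x \<in> M" using that U KM by blast+
    then obtain e where e: "e > 0" "mball x e \<subseteq> U"
      using U(1) unfolding openin_mtopology by blast
    \<comment> \<open>Two points of a ball are less than two radii apart, hence the half.\<close>
    obtain m where m: "x \<in> ?B m" "radius m < e / 2"
      using dense_basic_ball[OF cms x(2), of "e / 2"] e(1) by auto
    have "?B m \<subseteq> mball x e"
    proof
      fix y assume y: "y \<in> ?B m"
      have "d x y \<le> d x (s (pfst m)) + d (s (pfst m)) y"
        using m y x by (intro triangle) (auto simp: basic_ball_eq)
      also have "\<dots> < e"
        using m y by (auto simp: basic_ball_eq commute)
      finally show "y \<in> mball x e"
        using x y by (simp add: basic_ball_eq)
    qed
    with m(1) e(2) show ?thesis unfolding S_def by blast
  qed
  then have "C \<subseteq> (\<Union>m\<in>S. ?B m)" by blast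
  from compactin_finite_subcover[OF C openin_basic_ball[OF ms] this]
  obtain L where L: "finite L" "L \<subseteq> S" "C \<subseteq> (\<Union>m\<in>L. ?B m)"
    by (elim exE conjE)
  then have "C = K \<inter> (\<Union>m\<in>L. ?B m)"
    unfolding S_def using U(2) by blast
  with L(1) show ?thesis by blast
qed

section \<open>Free group words acting on the space\<close>

lemma free_group_map_Cons:
  "free_group_map G gs (l # w) =
    (if snd l then gs ! fst l else inv\<^bsub>G\<^esub> (gs ! fst l)) \<otimes>\<^bsub>G\<^esub> free_group_map G gs w"
  by (simp add: free_group_map_def split: prod.split)

lemma free_group_map_closed:
  assumes "group G" "set gs \<subseteq> carrier G" "w \<in> free_group_words (length gs)"
  shows "free_group_map G gs w \<in> carrier G"
proof -
  interpret group G by fact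
  have "fst ` set w \<subseteq> {..<length gs}"
    using assms(3) by (simp add: free_group_words_def)
  then show ?thesis
  proof (induction w)
    case (Cons l w)
    then have "gs ! fst l \<in> carrier G"
      using assms(2) by (auto simp: subset_iff)
    with Cons show ?case
      unfolding free_group_map_Cons by auto
  qed (simp add: free_group_map_def)
qed

text \<open>Codings evaluate the action at inverses, so each letter acts by the inverse of its
  value: odd codes are generators and even codes are inverses of generators.\<close>

definition letter_inverse :: "('g, 'b) monoid_scheme \<Rightarrow> 'g list \<Rightarrow> nat \<Rightarrow> 'g" where
  "letter_inverse G gs l = (if odd l then inv\<^bsub>G\<^esub> (gs ! (l div 2)) else gs ! (l div 2))"

text \<open>Inversion reverses a product, and the rightmost factor of the reversed product acts
  first. Applying the inverse letters in reading order therefore gives the inverse of the whole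
  word.\<close>

lemma fold_letter_inverse:
  assumes "group G" "group_action G K \<phi>" "set gs \<subseteq> carrier G"
    and "w \<in> free_group_words (length gs)" "x \<in> K"
  shows "fold (\<lambda>l. \<phi> (letter_inverse G gs l)) (map letter_code w) x =
    \<phi> (inv\<^bsub>G\<^esub> (free_group_map G gs w)) x"
proof -
  interpret group G by fact
  interpret group_action G K \<phi> by fact
  have "fst ` set w \<subseteq> {..<length gs}"
    using assms(4) by (simp add: free_group_words_def)
  then show ?thesis
    using assms(4,5)
  proof (induction w arbitrary: x)
    case Nil
    then have "\<phi> \<one>\<^bsub>G\<^esub> x = x"
      using id_eq_one by (metis restrict_apply')
    then show ?case by (simp add: free_group_map_def)
  next
    case (Cons l w)
    let ?h = "if snd l then gs ! fst l else inv\<^bsub>G\<^esub> (gs ! fst l)"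
    have w: "w \<in> free_group_words (length gs)"
      using Cons.prems(2) by (cases w) (auto simp: free_group_words_def)
    have gs: "gs ! fst l \<in> carrier G"
      using Cons.prems(1) assms(3) by (auto simp: subset_iff)
    have eq: "letter_inverse G gs (letter_code l) = inv\<^bsub>G\<^esub> ?h"
      using gs by (simp add: letter_inverse_def letter_code_def)
    have h: "?h \<in> carrier G" using gs by simp
    have "\<phi> (inv\<^bsub>G\<^esub> ?h) x \<in> K"
      using element_image[OF inv_closed[OF h] Cons.prems(3) refl] .
    with Cons.IH[OF _ w this] Cons.prems(1)
    have "fold (\<lambda>l. \<phi> (letter_inverse G gs l)) (map letter_code (l # w)) x =
      \<phi> (inv\<^bsub>G\<^esub> (free_group_map G gs w)) (\<phi> (inv\<^bsub>G\<^esub> ?h) x)"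
      by (simp add: eq)
    also have "\<dots> = \<phi> (inv\<^bsub>G\<^esub> (free_group_map G gs w) \<otimes>\<^bsub>G\<^esub> inv\<^bsub>G\<^esub> ?h) x"
      using h free_group_map_closed[OF assms(1,3) w] Cons.prems(3)
      by (intro composition_rule[symmetric]) simp_all
    also have "\<dots> = \<phi> (inv\<^bsub>G\<^esub> (free_group_map G gs (l # w))) x"
      unfolding free_group_map_Cons using h free_group_map_closed[OF assms(1,3) w]
      by (simp only: inv_mult_group)
    finally show ?case .
  qed
qed

text \<open>Works on the computable model \<open>K\<close> itself. \<open>F\<close> enters the
  algorithm only through finite lists of balls describing where it avoids each part.\<close>

lemma effective_coding_subshift:
  assumes G: "group G" and cms: "computable_metric_space M d s" and rc: "recursively_compact M d s K"
    and act: "computable_action G M d s K \<phi>" and Y: "top_action G Y \<psi>"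
    and F: "continuous_map (subtopology (Metric_space.mtopology M d) K) Y F" "F ` K = topspace Y"
      "\<And>g x. g \<in> carrier G \<Longrightarrow> x \<in> K \<Longrightarrow> F (\<phi> g x) = \<psi> g (F x)"
    and P: "clopen_partition Y n P"
  shows "effective_subshift G {1..n} (coding_subshift G Y \<psi> n P)"
proof -
  interpret group G by fact
  interpret Metric_space M d
    using cms by (simp add: computable_metric_space_def)
  let ?B = "basic_ball M d s" and ?T = "subtopology mtopology K"
  have K: "compactin mtopology K"
    using rc by (simp add: recursively_compact_def)
  then have KM: "K \<subseteq> M"
    using compactin_subset_topspace by fastforce
  then have top: "topspace ?T = K" by auto
  have top_act: "top_action G ?T \<phi>"
    using act by (simp add: computable_action_def)
  interpret group_action G K \<phi>
    using top_act unfolding top_action_def top by blast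
  obtain S where S: "finite S" "generating_set G S"
    "\<And>g. g \<in> S \<Longrightarrow> computable_map M d s K M d s (\<phi> g)"
    using act unfolding computable_action_def by blast
  \<comment> \<open>Effectiveness is proved for the very generating set whose elements act
    computably.\<close>
  obtain gs where gs: "set gs = S" "distinct gs"
    using finite_distinct_list[OF S(1)] by blast
  have SG: "set gs \<subseteq> carrier G"
    using S(2) gs by (simp add: generating_set_def)
  have one: "\<phi> \<one>\<^bsub>G\<^esub> x = x" if "x \<in> K" for x
    using id_eq_one that by (metis restrict_apply')
  have \<phi>K: "\<phi> g \<in> K \<rightarrow> K" if "g \<in> carrier G" for g
    using element_image[OF that] by blast
  let ?t = "\<lambda>l. \<phi> (letter_inverse G gs l)"
  have eff: "effective_map ?B K (?t l)" if "l < 2 * length gs" for l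
  proof -
    define g where "g = gs ! (l div 2)"
    have "g \<in> S" using that gs(1) by (auto simp: g_def)
    then have g: "g \<in> carrier G" using SG gs(1) by blast
    have e: "effective_map ?B K (\<phi> g)"
      using S(3)[OF \<open>g \<in> S\<close>] \<phi>K[OF g] by (rule effective_map_computable_map)
    have "effective_map ?B K (\<phi> (inv\<^bsub>G\<^esub> g))"
    proof (rule effective_map_inverse[OF cms rc e])
      show "continuous_map ?T ?T (\<phi> g)"
        using top_act g unfolding top_action_def by (blast intro: homeomorphic_imp_continuous_map)
      show "\<phi> (inv\<^bsub>G\<^esub> g) \<in> K \<rightarrow> K"
        using g by (intro \<phi>K) simp
      show "\<phi> g (\<phi> (inv\<^bsub>G\<^esub> g) x) = x" "\<phi> (inv\<^bsub>G\<^esub> g) (\<phi> g x) = x" if "x \<in> K" for x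
        using g one[OF that] by (simp_all flip: composition_rule[OF that])
    qed
    with e show ?thesis
      by (simp add: letter_inverse_def g_def)
  qed
  \<comment> \<open>The preimage of a clopen part is clopen in \<open>K\<close>, so its complement
    is both compact and relatively open.\<close>
  have "\<forall>a\<in>{1..n}. \<exists>L. finite L \<and> K - {x \<in> K. F x \<in> P a} = K \<inter> (\<Union>m\<in>L. ?B m)"
  proof
    fix a assume a: "a \<in> {1..n}"
    have "openin Y (P a)" "closedin Y (P a)"
      using P a by (auto simp: clopen_partition_def)
    then have PQ: "openin ?T {x \<in> topspace ?T. F x \<in> P a}" "closedin ?T {x \<in> topspace ?T. F x \<in> P a}"
      using F(1) by (blast intro: openin_continuous_map_preimage closedin_continuous_map_preimage)+
    have "closedin ?T (K - {x \<in> K. F x \<in> P a})" "openin ?T (K - {x \<in> K. F x \<in> P a})"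
      using closedin_diff[OF closedin_topspace PQ(1)] openin_diff[OF openin_topspace PQ(2)]
      unfolding top by blast+
    moreover have "compactin mtopology (K - {x \<in> K. F x \<in> P a})"
    proof -
      have "compact_space ?T" using K by (simp add: compact_space_subtopology)
      then have "compactin ?T (K - {x \<in> K. F x \<in> P a})"
        using calculation(1) by (rule closedin_compact_space)
      then show ?thesis by (simp add: compactin_subtopology)
    qed
    ultimately show "\<exists>L. finite L \<and> K - {x \<in> K. F x \<in> P a} = K \<inter> (\<Union>m\<in>L. ?B m)"
      using clopen_eq_finite_union_balls[OF cms KM] by blast
  qed
  from bchoice[OF this] obtain L where L':
    "\<forall>a\<in>{1..n}. finite (L a) \<and> K - {x \<in> K. F x \<in> P a} = K \<inter> (\<Union>m\<in>L a. ?B m)"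
    by (elim exE) (rule that)
  note L = bspec[OF L', THEN conjunct1] bspec[OF L', THEN conjunct2]
  \<comment> \<open>The symbol of the itinerary of \<open>F x\<close> at the element named by
    \<open>w\<close> is the part containing the image under \<open>F\<close> of the point reached
    from \<open>x\<close> along the inverse letters of \<open>w\<close>. Occurrence of a pattern
    thus becomes a statement about orbits in \<open>K\<close>.\<close>
  have occurs: "(\<exists>z\<in>pullback G gs (coding_subshift G Y \<psi> n P). \<forall>w\<in>dom p. p w = Some (z w)) \<longleftrightarrow>
      (\<exists>x\<in>K. \<forall>w\<in>dom p. fold ?t (map letter_code w) x \<in> {x \<in> K. F x \<in> P (the (p w))})"
    if p: "p \<in> patterns (length gs) {1..n}" for p
  proof -
    have words: "w \<in> free_group_words (length gs)" if "w \<in> dom p" for w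
      using p that by (auto simp: patterns_def)
    have fgm: "free_group_map G gs w \<in> carrier G" if "w \<in> dom p" for w
      using free_group_map_closed[OF G SG words[OF that]] .
    have fold: "fold ?t (map letter_code w) x \<in> K \<and>
        F (fold ?t (map letter_code w) x) = \<psi> (inv\<^bsub>G\<^esub> (free_group_map G gs w)) (F x)"
      if "w \<in> dom p" "x \<in> K" for w x
      unfolding fold_letter_inverse[OF G group_action_axioms SG words[OF that(1)] that(2)]
      using fgm[OF that(1)] that(2) \<phi>K F(3) by (simp add: Pi_iff)
    have "(\<forall>w\<in>dom p. p w = Some ((\<lambda>w\<in>free_group_words (length gs).
          itinerary G \<psi> n P (F x) (free_group_map G gs w)) w)) \<longleftrightarrow>
        (\<forall>w\<in>dom p. fold ?t (map letter_code w) x \<in> {x \<in> K. F x \<in> P (the (p w))})"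
      if x: "x \<in> K" for x
    proof (rule ball_cong[OF refl])
      fix w assume w: "w \<in> dom p"
      then obtain a where a: "p w = Some a" by blast
      then have an: "a \<in> {1..n}"
        using p by (auto simp: patterns_def intro: ranI)
      let ?y = "\<psi> (inv\<^bsub>G\<^esub> (free_group_map G gs w)) (F x)"
      have "F x \<in> topspace Y" using F(2) x by blast
      then have "?y \<in> topspace Y"
        using top_action_closed[OF Y inv_closed[OF fgm[OF w]]] by blast
      then have "part_of n P ?y = a \<longleftrightarrow> ?y \<in> P a"
        using part_of_mem[OF P] part_of_eq[OF P an] by blast
      with a fold[OF w x] fgm[OF w] words[OF w] show
        "(p w = Some ((\<lambda>w\<in>free_group_words (length gs).
            itinerary G \<psi> n P (F x) (free_group_map G gs w)) w)) \<longleftrightarrow>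
          fold ?t (map letter_code w) x \<in> {x \<in> K. F x \<in> P (the (p w))}"
        by (auto simp: itinerary_def)
    qed
    moreover have "pullback G gs (coding_subshift G Y \<psi> n P) = (\<lambda>x. \<lambda>w\<in>free_group_words (length gs).
        itinerary G \<psi> n P (F x) (free_group_map G gs w)) ` K"
      unfolding pullback_def coding_subshift_eq[OF G Y P] F(2)[symmetric] image_image ..
    ultimately show ?thesis by simp
  qed
  have "re_set (pattern_encode ` {p \<in> patterns (length gs) {1..n}.
    \<not> (\<exists>x\<in>K. \<forall>w\<in>dom p. fold ?t (map letter_code w) x \<in> {x \<in> K. F x \<in> P (the (p w))})})"
    using re_set_forbidden_patterns[OF semidecidable_cover[OF rc] K openin_basic_ball[OF Metric_space_axioms] eff
      finite_atLeastAtMost L] .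
  moreover have "{p \<in> patterns (length gs) {1..n}.
      \<not> (\<exists>x\<in>K. \<forall>w\<in>dom p. fold ?t (map letter_code w) x \<in> {x \<in> K. F x \<in> P (the (p w))})} =
    {p \<in> patterns (length gs) {1..n}.
      \<not> (\<exists>z\<in>pullback G gs (coding_subshift G Y \<psi> n P). \<forall>w\<in>dom p. p w = Some (z w))}"
    by (intro Collect_cong conj_cong refl arg_cong[where f = Not]) (simp only: occurs)
  ultimately have "effectively_closed (length gs) {1..n} (pullback G gs (coding_subshift G Y \<psi> n P))"
    unfolding effectively_closed_def by (simp only:)
  with S(2) gs subshift_coding_subshift[OF G Y P] show ?thesis
    unfolding effective_subshift_def by blast
qed

theorem proposition8p9:
  fixes G :: "('g, 'b) monoid_scheme"
    and X :: "'x topology" and \<phi> :: "'g \<Rightarrow> 'x \<Rightarrow> 'x"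
    and Y :: "'y topology" and \<psi> :: "'g \<Rightarrow> 'y \<Rightarrow> 'y"
  assumes "group G" and "finitely_generated G" and "recursively_presented G"
    and "EDS TYPE('m) G X \<phi>"
    and "zero_dim_action G Y \<psi>"
    and "topological_factor G X \<phi> Y \<psi>"
  shows "WEDS G Y \<psi>"
proof -
  from \<open>EDS TYPE('m) G X \<phi>\<close> obtain M :: "'m set" and d s K \<phi>' f where
    X: "top_action G X \<phi>" and cms: "computable_metric_space M d s" and
    rc: "recursively_compact M d s K" and act: "computable_action G M d s K \<phi>'" and
    f: "homeomorphic_map X (subtopology (Metric_space.mtopology M d) K) f"
      "equivariant G X \<phi> \<phi>' f"
    unfolding EDS_def topologically_conjugate_def by blast
  interpret Metric_space M d
    using cms by (simp add: computable_metric_space_def)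
  let ?T = "subtopology mtopology K"
  have "compactin mtopology K"
    using rc by (simp add: recursively_compact_def)
  then have top: "topspace ?T = K"
    using compactin_subset_topspace by fastforce
  from f(1) obtain f' where f': "continuous_map ?T X f'" "\<And>x. x \<in> topspace X \<Longrightarrow> f' (f x) = x"
      "\<And>y. y \<in> K \<Longrightarrow> f (f' y) = y" "continuous_map X ?T f"
    unfolding homeomorphic_map_maps homeomorphic_maps_def top by blast
  have f'X: "f' y \<in> topspace X" if "y \<in> K" for y
    using continuous_map_funspace[OF f'(1)] that unfolding top by blast
  from \<open>topological_factor G X \<phi> Y \<psi>\<close> obtain h where
    h: "continuous_map X Y h" "h ` topspace X = topspace Y" "equivariant G X \<phi> \<psi> h"
    unfolding topological_factor_def by blast
  have Y: "top_action G Y \<psi>"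
    using \<open>zero_dim_action G Y \<psi>\<close> by (simp add: zero_dim_action_def)
  \<comment> \<open>The conjugacy is absorbed into the factor map: \<open>Y\<close> is a factor of
    the computable model through the inverse conjugacy followed by \<open>h\<close>.\<close>
  have "effective_subshift G {1..n} (coding_subshift G Y \<psi> n P)" if "clopen_partition Y n P" for n P
  proof (rule effective_coding_subshift[OF \<open>group G\<close> cms rc act Y _ _ _ that])
    show "continuous_map ?T Y (h \<circ> f')"
      using f'(1) h(1) by (rule continuous_map_compose)
    have "f' ` K = topspace X"
    proof (intro equalityI subsetI)
      fix x assume x: "x \<in> topspace X"
      then have "f x \<in> K"
        using continuous_map_funspace[OF f'(4)] unfolding top by blast
      with f'(2)[OF x] show "x \<in> f' ` K" by force
    qed (use f'X in blast)
    with h(2) show "(h \<circ> f') ` K = topspace Y"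
      by (simp only: image_comp[symmetric])
    fix g y assume g: "g \<in> carrier G" and y: "y \<in> K"
    have "\<phi>' g y = f (\<phi> g (f' y))"
      using f(2) f'X[OF y] f'(3)[OF y] g unfolding equivariant_def by simp
    then have "f' (\<phi>' g y) = \<phi> g (f' y)"
      using f'(2) top_action_closed[OF X g f'X[OF y]] by simp
    then show "(h \<circ> f') (\<phi>' g y) = \<psi> g ((h \<circ> f') y)"
      using h(3) f'X[OF y] g unfolding equivariant_def by simp
  qed
  then show ?thesis
    unfolding WEDS_def using \<open>zero_dim_action G Y \<psi>\<close> by blast
qed

end
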